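(* Let $A$ be an $M$-approximately unital Banach algebra. Then ${\mathfrak F}_A$ is weak* dense in ${\mathfrak F}_{A^{**}}$, and ${\mathfrak r}_A$ is weak* dense in ${\mathfrak r}_{A^{**}}$. Consequently $A$ has a contractive approximate identity contained in $\frac{1}{2}{\mathfrak F}_A=\{a\in A:\|1-2a\|_{A^1}\le 1\}$.
   Context: All Banach algebras are complex with $\|xy\|\le\|x\|\|y\|$; "unital" means having an identity of norm $1$. A Banach algebra is approximately unital if it has a contractive approximate identity (cai): a net $(e_t)$ with $\|e_t\|\le 1$ and $e_ta\to a$, $ae_t\to a$ for all $a$. For approximately unital $A$, the multiplier unitization $A^1$ is $A$ if $A$ is unital, and otherwise is $A+\mathbb{C}1$ with norm $\|a+\lambda 1\|=\sup\{\|ac+\lambda c\|: c\in A,\ \|c\|\le 1\}$ (i.e. $A+\mathbb{C}I\subset B(A)$ via left multiplication). A state of a unital Banach algebra $B$ is $\varphi\in B^*$ with $\|\varphi\|=\varphi(1)=1$. Define ${\mathfrak F}_A=\{a\in A:\|1-a\|_{A^1}\le 1\}$ and ${\mathfrak r}_A=\{a\in A:\mathrm{Re}\,\varphi(a)\ge 0$ for all states $\varphi$ of $A^1\}$. Biduals carry the second Arens product, and $A^{**}$ is identified with $A^{\perp\perp}\subset (A^1)^{**}$; ${\mathfrak F}_{A^{**}}=\{\eta\in A^{**}:\|1-\eta\|_{(A^1)^{**}}\le 1\}$ and ${\mathfrak r}_{A^{**}}=A^{**}\cap{\mathfrak r}_{(A^1)^{**}}$, where ${\mathfrak r}_{(A^1)^{**}}$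 is the set of elements of the unital Banach algebra $(A^1)^{**}$ at which every state has nonnegative real part. A subspace $E$ of a Banach space $X$ is an $M$-ideal if there is a projection $P$ of $X^{**}$ onto $E^{\perp\perp}$ with $\|\eta\|=\max\{\|P\eta\|,\|\eta-P\eta\|\}$ for all $\eta\in X^{**}$. $A$ is $M$-approximately unital if it is approximately unital and $A$ is an $M$-ideal in $A^1$. *)

theory Defs
  imports Complex_Main
begin

definition complex_banach_algebra ::
  "(complex \<Rightarrow> 'a::{real_normed_algebra,banach} \<Rightarrow> 'a) \<Rightarrow> bool" where
  "complex_banach_algebra cs \<longleftrightarrow>
     (\<forall>c x y. cs c (x + y) = cs c x + cs c y) \<and>
     (\<forall>c d x. cs (c + d) x = cs c x + cs d x) \<and>
     (\<forall>c d x. cs (c * d) x = cs c (cs d x)) \<and>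
     (\<forall>r x. cs (complex_of_real r) x = scaleR r x) \<and>
     (\<forall>c x. norm (cs c x) = cmod c * norm x) \<and>
     (\<forall>c x y. cs c (x * y) = cs c x * y) \<and>
     (\<forall>c x y. cs c (x * y) = x * cs c y)"

text \<open>Elements of A^1 are represented by pairs (a, lambda) standing for a + lambda 1,
  with the multiplier (left regular) norm sup over the unit ball of A of norm(a c + lambda c).
  This covers both the unital case (where the norm is the norm of a + lambda 1 in A, and
  the representation has a kernel of norm zero) and the non-unital case.\<close>
definition unorm :: "(complex \<Rightarrow> 'a::{real_normed_algebra,banach} \<Rightarrow> 'a) \<Rightarrow> 'a \<times> complex \<Rightarrow> real" where
  "unorm cs x = Sup {norm (fst x * c + cs (snd x) c) | c. norm c \<le> 1}"

definition dual1 :: "(complex \<Rightarrow> 'a::{real_normed_algebra,banach} \<Rightarrow> 'a) \<Rightarrow> ('a \<times> complex \<Rightarrow> complex) set" where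
  "dual1 cs = {f. (\<forall>x y. f (fst x + fst y, snd x + snd y) = f x + f y) \<and>
                  (\<forall>c x. f (cs c (fst x), c * snd x) = c * f x) \<and>
                  (\<exists>K. \<forall>x. cmod (f x) \<le> K * unorm cs x)}"

definition dnorm1 :: "(complex \<Rightarrow> 'a::{real_normed_algebra,banach} \<Rightarrow> 'a) \<Rightarrow> ('a \<times> complex \<Rightarrow> complex) \<Rightarrow> real" where
  "dnorm1 cs f = Sup {cmod (f x) | x. unorm cs x \<le> 1}"

text \<open>The bidual (A^1)^** (elements are compared only through their values on dual1).\<close>
definition dual2 :: "(complex \<Rightarrow> 'a::{real_normed_algebra,banach} \<Rightarrow> 'a) \<Rightarrow> (('a \<times> complex \<Rightarrow> complex) \<Rightarrow> complex) set" where
  "dual2 cs = {P. (\<forall>f\<in>dual1 cs. \<forall>g\<in>dual1 cs. P (\<lambda>x. f x + g x) = P f + P g) \<and>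
                  (\<forall>c. \<forall>f\<in>dual1 cs. P (\<lambda>x. c * f x) = c * P f) \<and>
                  (\<exists>K. \<forall>f\<in>dual1 cs. cmod (P f) \<le> K * dnorm1 cs f)}"

definition bnorm :: "(complex \<Rightarrow> 'a::{real_normed_algebra,banach} \<Rightarrow> 'a) \<Rightarrow> (('a \<times> complex \<Rightarrow> complex) \<Rightarrow> complex) \<Rightarrow> real" where
  "bnorm cs P = Sup {cmod (P f) | f. f \<in> dual1 cs \<and> dnorm1 cs f \<le> 1}"

definition dual3 :: "(complex \<Rightarrow> 'a::{real_normed_algebra,banach} \<Rightarrow> 'a) \<Rightarrow> ((('a \<times> complex \<Rightarrow> complex) \<Rightarrow> complex) \<Rightarrow> complex) set" where
  "dual3 cs = {\<phi>. (\<forall>P\<in>dual2 cs. \<forall>Q\<in>dual2 cs. \<phi> (\<lambda>f. P f + Q f) = \<phi> P + \<phi> Q) \<and>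
                  (\<forall>c. \<forall>P\<in>dual2 cs. \<phi> (\<lambda>f. c * P f) = c * \<phi> P) \<and>
                  (\<exists>K. \<forall>P\<in>dual2 cs. cmod (\<phi> P) \<le> K * bnorm cs P)}"

definition tnorm :: "(complex \<Rightarrow> 'a::{real_normed_algebra,banach} \<Rightarrow> 'a) \<Rightarrow> ((('a \<times> complex \<Rightarrow> complex) \<Rightarrow> complex) \<Rightarrow> complex) \<Rightarrow> real" where
  "tnorm cs \<phi> = Sup {cmod (\<phi> P) | P. P \<in> dual2 cs \<and> bnorm cs P \<le> 1}"

definition canon :: "'b \<Rightarrow> ('b \<Rightarrow> complex) \<Rightarrow> complex" where
  "canon x = (\<lambda>f. f x)"

definition states1 :: "(complex \<Rightarrow> 'a::{real_normed_algebra,banach} \<Rightarrow> 'a) \<Rightarrow> ('a \<times> complex \<Rightarrow> complex) set" where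
  "states1 cs = {\<psi>\<in>dual1 cs. dnorm1 cs \<psi> = 1 \<and> \<psi> (0, 1) = 1}"

text \<open>States of the unital Banach algebra (A^1)^** (second Arens product), whose identity
  is the canonical image of the identity of A^1.\<close>
definition states2 :: "(complex \<Rightarrow> 'a::{real_normed_algebra,banach} \<Rightarrow> 'a) \<Rightarrow> ((('a \<times> complex \<Rightarrow> complex) \<Rightarrow> complex) \<Rightarrow> complex) set" where
  "states2 cs = {\<phi>\<in>dual3 cs. tnorm cs \<phi> = 1 \<and> \<phi> (canon (0, 1)) = 1}"

definition FA :: "(complex \<Rightarrow> 'a::{real_normed_algebra,banach} \<Rightarrow> 'a) \<Rightarrow> 'a set" where
  "FA cs = {a. unorm cs (- a, 1) \<le> 1}"

definition halfFA :: "(complex \<Rightarrow> 'a::{real_normed_algebra,banach} \<Rightarrow> 'a) \<Rightarrow> 'a set" where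
  "halfFA cs = {a. unorm cs (- cs 2 a, 1) \<le> 1}"

definition rA :: "(complex \<Rightarrow> 'a::{real_normed_algebra,banach} \<Rightarrow> 'a) \<Rightarrow> 'a set" where
  "rA cs = {a. \<forall>\<psi>\<in>states1 cs. Re (\<psi> (a, 0)) \<ge> 0}"

text \<open>A^** identified with A^perp-perp inside (A^1)^**, A being embedded as pairs (a,0).\<close>
definition Aperpperp :: "(complex \<Rightarrow> 'a::{real_normed_algebra,banach} \<Rightarrow> 'a) \<Rightarrow> (('a \<times> complex \<Rightarrow> complex) \<Rightarrow> complex) set" where
  "Aperpperp cs = {P\<in>dual2 cs. \<forall>f\<in>dual1 cs. (\<forall>a. f (a, 0) = 0) \<longrightarrow> P f = 0}"

definition FAbb :: "(complex \<Rightarrow> 'a::{real_normed_algebra,banach} \<Rightarrow> 'a) \<Rightarrow> (('a \<times> complex \<Rightarrow> complex) \<Rightarrow> complex) set" where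
  "FAbb cs = {P\<in>Aperpperp cs. bnorm cs (\<lambda>f. f (0, 1) - P f) \<le> 1}"

definition rAbb :: "(complex \<Rightarrow> 'a::{real_normed_algebra,banach} \<Rightarrow> 'a) \<Rightarrow> (('a \<times> complex \<Rightarrow> complex) \<Rightarrow> complex) set" where
  "rAbb cs = {P\<in>Aperpperp cs. \<forall>\<phi>\<in>states2 cs. Re (\<phi> P) \<ge> 0}"

definition weak_star_dense :: "(complex \<Rightarrow> 'a::{real_normed_algebra,banach} \<Rightarrow> 'a) \<Rightarrow>
    (('a \<times> complex \<Rightarrow> complex) \<Rightarrow> complex) set \<Rightarrow> (('a \<times> complex \<Rightarrow> complex) \<Rightarrow> complex) set \<Rightarrow> bool" where
  "weak_star_dense cs S T \<longleftrightarrow> S \<subseteq> T \<and>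
     (\<forall>P\<in>T. \<forall>F. finite F \<and> F \<subseteq> dual1 cs \<longrightarrow>
        (\<forall>\<epsilon>>0. \<exists>Q\<in>S. \<forall>f\<in>F. cmod (Q f - P f) < \<epsilon>))"

definition cai_in :: "'a::{real_normed_algebra,banach} set \<Rightarrow> bool" where
  "cai_in S \<longleftrightarrow> (\<exists>F::'a filter. F \<noteq> bot \<and> eventually (\<lambda>e. e \<in> S \<and> norm e \<le> 1) F \<and>
      (\<forall>a. ((\<lambda>e. e * a) \<longlongrightarrow> a) F \<and> ((\<lambda>e. a * e) \<longlongrightarrow> a) F))"

definition approx_unital :: "'a::{real_normed_algebra,banach} itself \<Rightarrow> bool" where
  "approx_unital _ \<longleftrightarrow> cai_in (UNIV :: 'a set)"

definition M_ideal_in_unitization :: "(complex \<Rightarrow> 'a::{real_normed_algebra,banach} \<Rightarrow> 'a) \<Rightarrow> bool" where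
  "M_ideal_in_unitization cs \<longleftrightarrow> (\<exists>Pr.
     (\<forall>P\<in>dual2 cs. Pr P \<in> Aperpperp cs) \<and>
     (\<forall>P\<in>dual2 cs. \<forall>Q\<in>dual2 cs. \<forall>f\<in>dual1 cs. Pr (\<lambda>g. P g + Q g) f = Pr P f + Pr Q f) \<and>
     (\<forall>c. \<forall>P\<in>dual2 cs. \<forall>f\<in>dual1 cs. Pr (\<lambda>g. c * P g) f = c * Pr P f) \<and>
     (\<forall>P\<in>Aperpperp cs. \<forall>f\<in>dual1 cs. Pr P f = P f) \<and>
     (\<forall>P\<in>dual2 cs. bnorm cs P = max (bnorm cs (Pr P)) (bnorm cs (\<lambda>f. P f - Pr P f))))"

definition M_approx_unital :: "(complex \<Rightarrow> 'a::{real_normed_algebra,banach} \<Rightarrow> 'a) \<Rightarrow> bool" where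
  "M_approx_unital cs \<longleftrightarrow> approx_unital TYPE('a) \<and> M_ideal_in_unitization cs"

end

theory Submission
  imports Defs "HOL-Analysis.Convex" "HOL-Analysis.Product_Vector" "HOL-Library.Function_Algebras"
begin

text \<open>Let \<open>P\<close> be the M-projection of \<open>(A\<^sup>1)\<^sup>*\<^sup>*\<close> onto the bidual of \<open>A\<close>. If \<open>\<parallel>1 - a\<parallel> \<le> 1 + d\<close>, then
  \<open>z = 1 + (a - 1) / (1 + d)\<close> lies within \<open>d\<close> of \<open>a\<close> and within 1 of 1, and by the maximum formula so does
  \<open>P z\<close>. A Hahn-Banach (Helly) argument replaces \<open>P z\<close> by an element of \<open>A\<close> at an arbitrarily small cost, and
  iterating gives an element of \<open>FA\<close> within \<open>4 d\<close> of \<open>a\<close>. Applied to a Helly approximant of an element of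
  the bidual this gives the first density. For the second, \<open>\<eta>\<close> is real positive precisely when
  \<open>\<parallel>1 - t \<eta>\<parallel> \<le> 1 + o(t)\<close>, so \<open>t \<eta>\<close> is approximated by \<open>FA\<close> up to \<open>o(t)\<close>, and \<open>FA / t\<close> consists of real
  positive elements.

  For the approximate identity, \<open>2 P(1)\<close> lies in \<open>FAbb\<close> because \<open>\<parallel>P(1) - (1 - P(1))\<parallel> \<le> 1\<close>. With \<open>z = 1 - P(1)\<close>,
  the operator \<open>(T f)(b) = z(f(\<cdot> b))\<close> on the dual of \<open>A\<close> satisfies \<open>\<parallel>1 + s T\<parallel> \<le> 1\<close> for \<open>\<bar>s\<bar> \<le> 1\<close>, since
  \<open>\<parallel>s z + c\<parallel> \<le> 1\<close> for \<open>c\<close> in the unit ball of \<open>A\<close>. As the identity is a vertex of the unit ball of operators,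
  \<open>T = 0\<close>, so \<open>P(1)\<close> acts as an identity on \<open>A\<close> on both sides. Elements of \<open>FA / 2\<close> converging weak* to \<open>P(1)\<close>
  are thus a weak approximate identity, and convexity makes it a norm one.\<close>

section \<open>Sublinear functionals and convex separation\<close>

text \<open>Functionals and elements of the bidual are plain functions; with the pointwise
  structure, \<open>subspace\<close> and \<open>convex\<close> apply to sets of them.\<close>

instantiation "fun" :: (type, real_vector) real_vector
begin

definition "scaleR r f = (\<lambda>x. scaleR r (f x))"

instance
  by standard (auto simp: scaleR_fun_def fun_eq_iff scaleR_add_right scaleR_add_left)

end

lemma scaleR_fun_apply [simp]: "(r *\<^sub>R f) x = r *\<^sub>R f x"
  by (simp add: scaleR_fun_def)

lemma minus_fun_apply [simp]: "(f - g) x = f x - g x" for f g :: "'b \<Rightarrow> 'c::ab_group_add"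
  by (simp add: fun_diff_def)

lemma uminus_fun_apply [simp]: "(- f) x = - f x" for f :: "'b \<Rightarrow> 'c::ab_group_add"
  by (simp add: fun_Compl_def)

text \<open>Relative to a set \<open>S\<close> because the dual and the bidual are sets of functions
  rather than types.\<close>

definition sublinear_on :: "'v::real_vector set \<Rightarrow> ('v \<Rightarrow> real) \<Rightarrow> bool" where
  "sublinear_on S p \<longleftrightarrow> (\<forall>x\<in>S. \<forall>y\<in>S. p (x + y) \<le> p x + p y) \<and>
                         (\<forall>r\<ge>0. \<forall>x\<in>S. p (r *\<^sub>R x) = r * p x)"

definition linear_functional_on :: "'v::real_vector set \<Rightarrow> ('v \<Rightarrow> real) \<Rightarrow> bool" where
  "linear_functional_on S f \<longleftrightarrow> (\<forall>x\<in>S. \<forall>y\<in>S. f (x + y) = f x + f y) \<and>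
                                 (\<forall>r. \<forall>x\<in>S. f (r *\<^sub>R x) = r * f x)"

text \<open>Scaling by \<open>inverse r\<close> turns the assumed inequality into its reverse, so
  one direction for positive \<open>r\<close> suffices.\<close>

lemma sublinear_onI:
  assumes S: "subspace S"
    and add: "\<And>x y. x \<in> S \<Longrightarrow> y \<in> S \<Longrightarrow> p (x + y) \<le> p x + p y"
    and scale: "\<And>r x. r > 0 \<Longrightarrow> x \<in> S \<Longrightarrow> p (r *\<^sub>R x) \<le> r * p x"
    and zero: "p 0 = 0"
  shows "sublinear_on S p"
  unfolding sublinear_on_def
proof (intro conjI ballI allI impI)
  fix r :: real and x assume r: "r \<ge> 0" and x: "x \<in> S"
  show "p (r *\<^sub>R x) = r * p x"
  proof (cases "r = 0")
    case False
    then have "r > 0" using r by simp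
    have "p (inverse r *\<^sub>R (r *\<^sub>R x)) \<le> inverse r * p (r *\<^sub>R x)"
      using scale[of "inverse r" "r *\<^sub>R x"] subspace_scale[OF S x] \<open>r > 0\<close> by simp
    then have "r * p x \<le> p (r *\<^sub>R x)" using \<open>r > 0\<close> by (simp add: field_simps)
    then show ?thesis using scale[OF \<open>r > 0\<close> x] by simp
  qed (use zero in auto)
qed (use add in auto)

lemma sublinear_on_zero: "subspace S \<Longrightarrow> sublinear_on S p \<Longrightarrow> p 0 = 0"
  unfolding sublinear_on_def by (metis mult_zero_left order_refl scale_zero_left subspace_0)

lemma sublinear_on_minus_le:
  assumes "subspace S" "sublinear_on S p" "x \<in> S"
  shows "- p (- x) \<le> p x"
proof -
  have "p (x + - x) \<le> p x + p (- x)"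
    using assms subspace_neg unfolding sublinear_on_def by blast
  then show ?thesis using sublinear_on_zero[OF assms(1,2)] by simp
qed

text \<open>For \<open>C\<close> convex with \<open>p \<ge> c\<close> on it, this is the largest
  sublinear \<open>q \<le> p\<close> such that \<open>q (- x) \<le> - c\<close> for all
  \<open>x\<close> in \<open>C\<close>. A linear functional below it is therefore at least
  \<open>c\<close> on \<open>C\<close>.\<close>

definition infconv :: "('v::real_vector \<Rightarrow> real) \<Rightarrow> 'v set \<Rightarrow> real \<Rightarrow> 'v \<Rightarrow> real" where
  "infconv p C c v = (INF z\<in>{0..} \<times> C. p (v + fst z *\<^sub>R snd z) - fst z * c)"

context
  fixes S :: "'v::real_vector set" and p :: "'v \<Rightarrow> real" and C :: "'v set" and c :: real
  assumes S: "subspace S" and p: "sublinear_on S p" and CS: "C \<subseteq> S" and ne: "C \<noteq> {}"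
    and cvx: "convex C" and pc: "\<And>x. x \<in> C \<Longrightarrow> c \<le> p x"
begin

text \<open>Subadditivity for \<open>s x = (v + s x) + (- v)\<close>, together with
  \<open>c \<le> p x\<close>; this keeps the infimum finite.\<close>

lemma infconv_lower_bound:
  assumes "v \<in> S" "s \<ge> 0" "x \<in> C"
  shows "- p (- v) \<le> p (v + s *\<^sub>R x) - s * c"
proof -
  have x: "x \<in> S" using assms CS by auto
  have m: "v + s *\<^sub>R x \<in> S" "- v \<in> S"
    using assms x S by (auto intro: subspace_add subspace_scale subspace_neg)
  have "p ((v + s *\<^sub>R x) + - v) \<le> p (v + s *\<^sub>R x) + p (- v)"
    using p m unfolding sublinear_on_def by blast
  moreover have "p ((v + s *\<^sub>R x) + - v) = s * p x"
    using p x assms unfolding sublinear_on_def by simp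
  moreover have "s * c \<le> s * p x" using pc assms by (intro mult_left_mono) auto
  ultimately show ?thesis by linarith
qed

lemma infconv_bdd_below:
  assumes "v \<in> S"
  shows "bdd_below ((\<lambda>z. p (v + fst z *\<^sub>R snd z) - fst z * c) ` ({0..} \<times> C))"
  using infconv_lower_bound[OF assms] by (auto intro!: bdd_belowI2)

lemma infconv_le:
  assumes "v \<in> S" "s \<ge> 0" "x \<in> C"
  shows "infconv p C c v \<le> p (v + s *\<^sub>R x) - s * c"
  unfolding infconv_def
  using cINF_lower[OF infconv_bdd_below[OF assms(1)], of "(s, x)"] assms by simp

lemma infconv_ge:
  assumes "\<And>s x. s \<ge> 0 \<Longrightarrow> x \<in> C \<Longrightarrow> K \<le> p (v + s *\<^sub>R x) - s * c"
  shows "K \<le> infconv p C c v"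
  unfolding infconv_def by (rule cINF_greatest) (use assms ne in auto)

lemma infconv_le_self: "v \<in> S \<Longrightarrow> infconv p C c v \<le> p v"
  using infconv_le[of v 0] ne by auto

lemma infconv_uminus_le: "x \<in> C \<Longrightarrow> infconv p C c (- x) \<le> - c"
  using infconv_le[of "- x" 1 x] CS S sublinear_on_zero[OF S p] by (auto intro: subspace_neg)

lemma sublinear_on_infconv: "sublinear_on S (infconv p C c)"
proof (rule sublinear_onI[OF S])
  fix v w assume v: "v \<in> S" and w: "w \<in> S"
  have vw: "v + w \<in> S" using S v w by (rule subspace_add)
  have *: "infconv p C c (v + w) \<le> (p (v + s *\<^sub>R x) - s * c) + (p (w + t *\<^sub>R y) - t * c)"
    if h: "s \<ge> 0" "x \<in> C" "t \<ge> 0" "y \<in> C" for s t x y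
  proof -
    \<comment> \<open>Here convexity enters: two rays through \<open>C\<close> add up to a single
      ray. If \<open>s + t = 0\<close>, any point of \<open>C\<close> serves.\<close>
    have "\<exists>u\<in>C. (s + t) *\<^sub>R u = s *\<^sub>R x + t *\<^sub>R y"
    proof (cases "s + t = 0")
      case True
      then have "s = 0" "t = 0" using h by auto
      then show ?thesis using h by auto
    next
      case False
      then have pos: "s + t > 0" using h by linarith
      let ?u = "(s / (s + t)) *\<^sub>R x + (t / (s + t)) *\<^sub>R y"
      have "?u \<in> C"
        using cvx h pos by (intro convexD) (auto simp: add_divide_distrib[symmetric])
      moreover have "(s + t) *\<^sub>R ?u = s *\<^sub>R x + t *\<^sub>R y"
        using pos by (simp add: scaleR_add_right)
      ultimately show ?thesis by blast
    qed
    then obtain u where u: "u \<in> C" "(s + t) *\<^sub>R u = s *\<^sub>R x + t *\<^sub>R y" by blast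
    have "infconv p C c (v + w) \<le> p ((v + w) + (s + t) *\<^sub>R u) - (s + t) * c"
      by (rule infconv_le) (use vw u h in auto)
    also have "(v + w) + (s + t) *\<^sub>R u = (v + s *\<^sub>R x) + (w + t *\<^sub>R y)" by (simp add: u)
    also have "p \<dots> \<le> p (v + s *\<^sub>R x) + p (w + t *\<^sub>R y)"
      using p v w h CS S unfolding sublinear_on_def
      by (meson subsetD subspace_add subspace_scale)
    finally show ?thesis by (simp add: algebra_simps)
  qed
  \<comment> \<open>The infimum is taken first over \<open>(s, x)\<close> and then over
    \<open>(t, y)\<close>.\<close>
  have "infconv p C c (v + w) - (p (w + t *\<^sub>R y) - t * c) \<le> infconv p C c v"
    if "t \<ge> 0" "y \<in> C" for t y
    by (rule infconv_ge) (use * that in fastforce)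
  then have "infconv p C c (v + w) - infconv p C c v \<le> infconv p C c w"
    by (intro infconv_ge) (force simp: algebra_simps)
  then show "infconv p C c (v + w) \<le> infconv p C c v + infconv p C c w" by simp
next
  fix r :: real and v assume r: "r > 0" and v: "v \<in> S"
  have "inverse r * infconv p C c (r *\<^sub>R v) \<le> infconv p C c v"
  proof (rule infconv_ge)
    fix s :: real and x assume h: "s \<ge> 0" "x \<in> C"
    have m: "v + s *\<^sub>R x \<in> S" using v h CS S by (auto intro: subspace_add subspace_scale)
    have "infconv p C c (r *\<^sub>R v) \<le> p (r *\<^sub>R v + (r * s) *\<^sub>R x) - (r * s) * c"
      by (rule infconv_le) (use v S h r in \<open>auto intro: subspace_scale\<close>)
    also have "r *\<^sub>R v + (r * s) *\<^sub>R x = r *\<^sub>R (v + s *\<^sub>R x)" by (simp add: scaleR_add_right)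
    also have "p \<dots> = r * p (v + s *\<^sub>R x)" using p m r unfolding sublinear_on_def by simp
    finally show "inverse r * infconv p C c (r *\<^sub>R v) \<le> p (v + s *\<^sub>R x) - s * c"
      using r by (simp add: field_simps)
  qed
  then show "infconv p C c (r *\<^sub>R v) \<le> r * infconv p C c v"
    using r by (simp add: field_simps)
next
  have z: "0 \<in> S" using S by (rule subspace_0)
  have "0 \<le> infconv p C c 0"
    using infconv_lower_bound[OF z] sublinear_on_zero[OF S p] by (intro infconv_ge) simp
  moreover have "infconv p C c 0 \<le> 0"
    using infconv_le_self[OF z] sublinear_on_zero[OF S p] by simp
  ultimately show "infconv p C c 0 = 0" by simp
qed

end

text \<open>Zorn's lemma on the sublinear functionals below \<open>p\<close>. The pointwise infimum
  of a chain stays finite because \<open>- p (- x) \<le> q x\<close> for every member, and it is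
  subadditive because the smaller of two members can be used in place of both.\<close>

lemma exists_minimal_sublinear:
  assumes S: "subspace S" and p: "sublinear_on S p"
  shows "\<exists>m. sublinear_on S m \<and> (\<forall>x\<in>S. m x \<le> p x) \<and>
           (\<forall>q. sublinear_on S q \<and> (\<forall>x\<in>S. q x \<le> m x) \<longrightarrow> (\<forall>x\<in>S. q x = m x))"
proof -
  \<comment> \<open>Values off \<open>S\<close> are fixed at 0, so comparing total functions amounts
    to comparing them on \<open>S\<close>.\<close>
  define A where "A = {q. sublinear_on S q \<and> (\<forall>x\<in>S. q x \<le> p x) \<and> (\<forall>x. x \<notin> S \<longrightarrow> q x = 0)}"
  \<comment> \<open>The order is reversed because \<open>predicate_Zorn\<close> yields maximal
    elements.\<close>
  define Q :: "('a \<Rightarrow> real) \<Rightarrow> ('a \<Rightarrow> real) \<Rightarrow> bool" where "Q = (\<lambda>q q'. q' \<le> q)"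
  have restr: "sublinear_on S (\<lambda>x. if x \<in> S then q x else 0) \<longleftrightarrow> sublinear_on S q" for q
    unfolding sublinear_on_def using S by (auto simp: subspace_add subspace_scale)
  have "\<exists>m\<in>A. \<forall>a\<in>A. Q m a \<longrightarrow> a = m"
  proof (rule predicate_Zorn)
    show "partial_order_on A (relation_of Q A)"
      by (rule partial_order_on_relation_ofI) (auto simp: Q_def)
  next
    fix C assume C: "C \<in> Chains (relation_of Q A)"
    then have CA: "C \<subseteq> A" and tot: "\<And>a b. a \<in> C \<Longrightarrow> b \<in> C \<Longrightarrow> a \<le> b \<or> b \<le> a"
      by (auto simp: Chains_def relation_of_def Q_def)
    show "\<exists>u\<in>A. \<forall>a\<in>C. Q a u"
    proof (cases "C = {}")
      case True
      have "(\<lambda>x. if x \<in> S then p x else 0) \<in> A"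
        using p by (simp add: A_def restr)
      then show ?thesis using True by auto
    next
      case ne: False
      define u where "u = (\<lambda>x. INF q\<in>C. q x)"
      have bdd: "bdd_below ((\<lambda>q. q x) ` C)" for x
      proof (cases "x \<in> S")
        case True
        then have mx: "- x \<in> S" using S by (simp add: subspace_neg)
        have "- p (- x) \<le> q x" if "q \<in> C" for q
        proof -
          have "q \<in> A" using that CA by auto
          then have "- q (- x) \<le> q x" "q (- x) \<le> p (- x)"
            using sublinear_on_minus_le[OF S _ True] mx by (auto simp: A_def)
          then show ?thesis by linarith
        qed
        then show ?thesis by (auto intro!: bdd_belowI2)
      next
        case False
        then show ?thesis using CA by (auto intro!: bdd_belowI2[of _ 0] simp: A_def subset_iff)
      qed
      have le: "u x \<le> q x" if "q \<in> C" for q x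
        unfolding u_def using bdd that by (rule cINF_lower)
      have ge: "K \<le> u x" if "\<And>q. q \<in> C \<Longrightarrow> K \<le> q x" for K x
        unfolding u_def using ne that by (rule cINF_greatest)
      have z: "q 0 = 0" if "q \<in> C" for q
        using CA that sublinear_on_zero[OF S] by (auto simp: A_def)
      have "sublinear_on S u"
      proof (rule sublinear_onI[OF S])
        fix x y assume xy: "x \<in> S" "y \<in> S"
        have *: "u (x + y) \<le> q x + q' y" if "q \<in> C" "q' \<in> C" for q q'
        proof -
          obtain r where r: "r \<in> C" "r \<le> q" "r \<le> q'"
            using tot[OF \<open>q \<in> C\<close> \<open>q' \<in> C\<close>] \<open>q \<in> C\<close> \<open>q' \<in> C\<close> by blast
          have "u (x + y) \<le> r (x + y)" using le r by auto
          also have "\<dots> \<le> r x + r y"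
            using r(1) CA xy by (auto simp: A_def sublinear_on_def)
          also have "\<dots> \<le> q x + q' y" using r by (auto intro!: add_mono dest: le_funD)
          finally show ?thesis .
        qed
        have "u (x + y) - q' y \<le> u x" if "q' \<in> C" for q'
          by (rule ge) (use * that in fastforce)
        then have "u (x + y) - u x \<le> u y" by (intro ge) (force simp: algebra_simps)
        then show "u (x + y) \<le> u x + u y" by simp
      next
        fix r :: real and x assume r: "r > 0" and x: "x \<in> S"
        have "inverse r * u (r *\<^sub>R x) \<le> u x"
        proof (rule ge)
          fix q assume q: "q \<in> C"
          then have "q (r *\<^sub>R x) = r * q x" using CA r x by (auto simp: A_def sublinear_on_def)
          then show "inverse r * u (r *\<^sub>R x) \<le> q x"
            using le[OF q, of "r *\<^sub>R x"] r by (simp add: field_simps)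
        qed
        then show "u (r *\<^sub>R x) \<le> r * u x" using r by (simp add: field_simps)
      next
        have "0 \<le> u 0" by (rule ge) (simp add: z)
        moreover obtain q where "q \<in> C" using ne by auto
        ultimately show "u 0 = 0" using le[of q 0] z by force
      qed
      moreover have "u x \<le> p x" if "x \<in> S" for x
      proof -
        obtain q where q: "q \<in> C" using ne by auto
        then have "q x \<le> p x" using CA that by (auto simp: A_def)
        then show ?thesis using le[OF q, of x] by linarith
      qed
      moreover have "u x = 0" if "x \<notin> S" for x
      proof -
        have "(\<lambda>q. q x) ` C = (\<lambda>q. 0) ` C" using CA that by (intro image_cong) (auto simp: A_def)
        then show ?thesis using ne by (simp add: u_def)
      qed
      ultimately have "u \<in> A" by (simp add: A_def)
      then show ?thesis using le by (auto simp: Q_def le_fun_def)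
    qed
  qed
  then obtain m where m: "m \<in> A" and min: "\<And>a. a \<in> A \<Longrightarrow> a \<le> m \<Longrightarrow> a = m"
    by (auto simp: Q_def)
  have "q x = m x" if q: "sublinear_on S q" "\<forall>x\<in>S. q x \<le> m x" and x: "x \<in> S" for q x
  proof -
    let ?q = "\<lambda>x. if x \<in> S then q x else 0"
    have "?q \<in> A" using q m restr by (fastforce simp: A_def)
    moreover have "?q \<le> m" using q m by (auto simp: le_fun_def A_def)
    ultimately have "?q = m" by (rule min)
    then show ?thesis using x by (metis (mono_tags))
  qed
  then show ?thesis using m by (auto simp: A_def)
qed

text \<open>A minimal sublinear functional \<open>m\<close> equals \<open>infconv m {y} (m y)\<close> for every \<open>y\<close>, which forces
  \<open>m (- y) = - m y\<close> and hence linearity.\<close>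
theorem hahn_banach_sublinear:
  assumes S: "subspace S" and p: "sublinear_on S p"
  shows "\<exists>f. linear_functional_on S f \<and> (\<forall>x\<in>S. f x \<le> p x)"
proof -
  obtain m where m: "sublinear_on S m" "\<And>x. x \<in> S \<Longrightarrow> m x \<le> p x"
    and min: "\<And>q x. sublinear_on S q \<Longrightarrow> (\<And>x. x \<in> S \<Longrightarrow> q x \<le> m x) \<Longrightarrow> x \<in> S \<Longrightarrow> q x = m x"
    using exists_minimal_sublinear[OF S p] by blast
  have neg: "m (- y) = - m y" if y: "y \<in> S" for y
  proof -
    have "infconv m {y} (m y) (- y) = m (- y)"
      by (rule min; (rule sublinear_on_infconv infconv_le_self)?)
         (use S m y in \<open>auto intro: subspace_neg\<close>)
    moreover have "infconv m {y} (m y) (- y) \<le> - m y"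
      by (rule infconv_uminus_le) (use S m y in auto)
    ultimately show ?thesis using sublinear_on_minus_le[OF S m(1) y] by simp
  qed
  have "linear_functional_on S m"
    unfolding linear_functional_on_def
  proof (intro conjI ballI allI)
    fix x y assume x: "x \<in> S" and y: "y \<in> S"
    have "m ((x + y) + - y) \<le> m (x + y) + m (- y)"
      using m(1) x y S unfolding sublinear_on_def by (meson subspace_add subspace_neg)
    then have "m x + m y \<le> m (x + y)" using neg[OF y] by simp
    then show "m (x + y) = m x + m y" using m(1) x y unfolding sublinear_on_def by force
  next
    fix r :: real and x assume x: "x \<in> S"
    show "m (r *\<^sub>R x) = r * m x"
    proof (cases "r \<ge> 0")
      case True
      then show ?thesis using m(1) x unfolding sublinear_on_def by simp
    next
      case False
      then have "- r \<ge> 0" by simp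
      then have "m ((- r) *\<^sub>R x) = - r * m x" using m(1) x unfolding sublinear_on_def by blast
      then show ?thesis using neg[OF subspace_scale[OF S x, of r]] by simp
    qed
  qed
  then show ?thesis using m by blast
qed

text \<open>Hahn-Banach is applied to \<open>infconv p C c\<close>, which lies below
  \<open>p\<close> and is at most \<open>- c\<close> on \<open>- C\<close>; linearity turns the
  latter into a lower bound on \<open>C\<close>.\<close>

theorem convex_separation:
  assumes S: "subspace S" and p: "sublinear_on S p" and C: "C \<subseteq> S" "C \<noteq> {}" "convex C"
    and pc: "\<And>x. x \<in> C \<Longrightarrow> c \<le> p x"
  obtains f where "linear_functional_on S f" "\<And>x. x \<in> S \<Longrightarrow> f x \<le> p x" "\<And>x. x \<in> C \<Longrightarrow> c \<le> f x"
proof -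
  obtain f where f: "linear_functional_on S f" "\<And>x. x \<in> S \<Longrightarrow> f x \<le> infconv p C c x"
    using hahn_banach_sublinear[OF S sublinear_on_infconv[OF S p C pc]] by blast
  have "f x \<le> p x" if "x \<in> S" for x
    using f(2)[OF that] infconv_le_self[OF S p C pc that] by linarith
  moreover have "c \<le> f x" if x: "x \<in> C" for x
  proof -
    have xS: "x \<in> S" using x C by auto
    have "f (- x) = - f x"
      using f(1) xS unfolding linear_functional_on_def by (metis mult_minus1 scaleR_minus1_left)
    then show ?thesis
      using f(2)[OF subspace_neg[OF S xS]] infconv_uminus_le[OF S p C pc x] by linarith
  qed
  ultimately show ?thesis using that f(1) by blast
qed

section \<open>Complex seminormed spaces and their duals\<close>

lemma obtain_phase:
  obtains u where "cmod u = 1" "u * z = complex_of_real (cmod z)"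
proof (cases "z = 0")
  case True
  then show thesis using that[of 1] by simp
next
  case False
  let ?u = "cnj z / of_real (cmod z)"
  have "?u * z = of_real ((cmod z)\<^sup>2) / of_real (cmod z)"
    using complex_norm_square[of z] by (simp add: mult.commute)
  also have "\<dots> = of_real (cmod z)" using False by (simp add: power2_eq_square)
  finally show thesis using that[of ?u] False by (simp add: norm_divide)
qed

text \<open>Covers \<open>A\<close>, \<open>A^1\<close>, the dual and the bidual at once. Only a
  seminorm is asked for: on \<open>A^1\<close> it has a kernel when \<open>A\<close> is unital, and
  bidual elements with equal values on \<open>dual1\<close> are at distance 0.\<close>

locale complex_seminormed =
  fixes S :: "'v::real_vector set" and sc :: "complex \<Rightarrow> 'v \<Rightarrow> 'v" and \<nu> :: "'v \<Rightarrow> real"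
  assumes subspace: "subspace S"
    and sc_closed: "x \<in> S \<Longrightarrow> sc c x \<in> S"
    and sc_add: "x \<in> S \<Longrightarrow> y \<in> S \<Longrightarrow> sc c (x + y) = sc c x + sc c y"
    and sc_add_left: "x \<in> S \<Longrightarrow> sc (c + d) x = sc c x + sc d x"
    and sc_sc: "x \<in> S \<Longrightarrow> sc (c * d) x = sc c (sc d x)"
    and sc_of_real: "x \<in> S \<Longrightarrow> sc (complex_of_real r) x = r *\<^sub>R x"
    and triangle: "x \<in> S \<Longrightarrow> y \<in> S \<Longrightarrow> \<nu> (x + y) \<le> \<nu> x + \<nu> y"
    and seminorm_sc: "x \<in> S \<Longrightarrow> \<nu> (sc c x) = cmod c * \<nu> x"
begin

definition cdual :: "('v \<Rightarrow> complex) set" where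
  "cdual = {f. (\<forall>x\<in>S. \<forall>y\<in>S. f (x + y) = f x + f y) \<and> (\<forall>c. \<forall>x\<in>S. f (sc c x) = c * f x) \<and>
               (\<exists>K. \<forall>x\<in>S. cmod (f x) \<le> K * \<nu> x)}"

definition cnorm :: "('v \<Rightarrow> complex) \<Rightarrow> real" where
  "cnorm f = Sup {cmod (f x) |x. x \<in> S \<and> \<nu> x \<le> 1}"

lemma seminorm_scaleR: "x \<in> S \<Longrightarrow> \<nu> (r *\<^sub>R x) = \<bar>r\<bar> * \<nu> x"
  using seminorm_sc[of x "of_real r"] by (simp add: sc_of_real)

lemma seminorm_zero: "\<nu> 0 = 0"
  using seminorm_scaleR[of 0 0] subspace_0[OF subspace] by simp

lemma seminorm_uminus: "x \<in> S \<Longrightarrow> \<nu> (- x) = \<nu> x"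
  using seminorm_scaleR[of x "-1"] by simp

lemma seminorm_nonneg: "x \<in> S \<Longrightarrow> 0 \<le> \<nu> x"
  using triangle[of x "- x"] seminorm_uminus subspace_neg[OF subspace] seminorm_zero by fastforce

lemma sublinear_on_seminorm: "sublinear_on S \<nu>"
  by (rule sublinear_onI[OF subspace]) (auto simp: triangle seminorm_scaleR seminorm_zero)

lemma cdual_add: "f \<in> cdual \<Longrightarrow> x \<in> S \<Longrightarrow> y \<in> S \<Longrightarrow> f (x + y) = f x + f y"
  by (simp add: cdual_def)

lemma cdual_sc: "f \<in> cdual \<Longrightarrow> x \<in> S \<Longrightarrow> f (sc c x) = c * f x"
  by (simp add: cdual_def)

lemma cdual_scaleR: "f \<in> cdual \<Longrightarrow> x \<in> S \<Longrightarrow> f (r *\<^sub>R x) = r *\<^sub>R f x"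
  using cdual_sc[of f x "of_real r"] by (simp add: sc_of_real scaleR_conv_of_real)

lemma cdual_uminus: "f \<in> cdual \<Longrightarrow> x \<in> S \<Longrightarrow> f (- x) = - f x"
  using cdual_scaleR[of f x "-1"] by simp

lemma cdual_diff: "f \<in> cdual \<Longrightarrow> x \<in> S \<Longrightarrow> y \<in> S \<Longrightarrow> f (x - y) = f x - f y"
  using cdual_add[of f x "- y"] subspace_neg[OF subspace] by (simp add: cdual_uminus)

lemma cdualE_nonneg:
  assumes "f \<in> cdual"
  obtains K where "K \<ge> 0" "\<And>x. x \<in> S \<Longrightarrow> cmod (f x) \<le> K * \<nu> x"
proof -
  obtain K where "\<And>x. x \<in> S \<Longrightarrow> cmod (f x) \<le> K * \<nu> x" using assms unfolding cdual_def by blast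
  then have "cmod (f x) \<le> max K 0 * \<nu> x" if "x \<in> S" for x
    using that seminorm_nonneg by (meson max.cobounded1 mult_right_mono order_trans)
  then show thesis using that[of "max K 0"] by simp
qed

lemma cnorm_set_ne: "{cmod (f x) |x. x \<in> S \<and> \<nu> x \<le> 1} \<noteq> {}"
  using subspace_0[OF subspace] seminorm_zero by force

lemma cnorm_bdd:
  assumes "f \<in> cdual"
  shows "bdd_above {cmod (f x) |x. x \<in> S \<and> \<nu> x \<le> 1}"
proof -
  obtain K where "K \<ge> 0" "\<And>x. x \<in> S \<Longrightarrow> cmod (f x) \<le> K * \<nu> x" using cdualE_nonneg[OF assms] by blast
  then have "cmod (f x) \<le> K" if "x \<in> S" "\<nu> x \<le> 1" for x
    using that by (meson mult_left_le order_trans)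
  then show ?thesis by (auto intro!: bdd_aboveI)
qed

lemma cnorm_upper: "f \<in> cdual \<Longrightarrow> x \<in> S \<Longrightarrow> \<nu> x \<le> 1 \<Longrightarrow> cmod (f x) \<le> cnorm f"
  unfolding cnorm_def by (rule cSup_upper) (auto intro: cnorm_bdd)

lemma cnorm_least: "(\<And>x. x \<in> S \<Longrightarrow> \<nu> x \<le> 1 \<Longrightarrow> cmod (f x) \<le> K) \<Longrightarrow> cnorm f \<le> K"
  unfolding cnorm_def by (rule cSup_least[OF cnorm_set_ne]) auto

lemma cnorm_le: "K \<ge> 0 \<Longrightarrow> (\<And>x. x \<in> S \<Longrightarrow> cmod (f x) \<le> K * \<nu> x) \<Longrightarrow> cnorm f \<le> K"
  by (rule cnorm_least) (meson mult_left_le order_trans)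

lemma cnorm_bound:
  assumes f: "f \<in> cdual" and x: "x \<in> S"
  shows "cmod (f x) \<le> cnorm f * \<nu> x"
proof (cases "\<nu> x = 0")
  case True
  \<comment> \<open>Rescaling to seminorm 1 is impossible here, but any bound \<open>K\<close> gives
    \<open>f x = 0\<close>.\<close>
  obtain K where "cmod (f x) \<le> K * \<nu> x" using f x by (auto simp: cdual_def)
  then show ?thesis using True by simp
next
  case False
  then have pos: "\<nu> x > 0" using seminorm_nonneg[OF x] by simp
  let ?y = "inverse (\<nu> x) *\<^sub>R x"
  have y: "?y \<in> S" "\<nu> ?y \<le> 1"
    using subspace_scale[OF subspace x] pos by (auto simp: seminorm_scaleR[OF x])
  have "inverse (\<nu> x) * cmod (f x) = cmod (f ?y)"
    using pos by (simp add: cdual_scaleR[OF f x])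
  also have "\<dots> \<le> cnorm f" using cnorm_upper[OF f y] .
  finally show ?thesis using pos by (simp add: field_simps)
qed

lemma cnorm_nonneg: "f \<in> cdual \<Longrightarrow> 0 \<le> cnorm f"
  using cnorm_upper[of f 0] subspace_0[OF subspace] seminorm_zero norm_ge_zero order_trans
  by (metis zero_le_one)

text \<open>Lets the passage to the dual be iterated, so that functionals on \<open>A^1\<close>, on
  its dual and on its bidual share the lemmas above.\<close>

lemma complex_seminormed_dual: "complex_seminormed cdual (\<lambda>c f x. c * f x) cnorm"
proof
  have add: "f + g \<in> cdual" if f: "f \<in> cdual" and g: "g \<in> cdual" for f g
  proof -
    have "cmod ((f + g) x) \<le> (cnorm f + cnorm g) * \<nu> x" if "x \<in> S" for x
      using cnorm_bound[OF f that] cnorm_bound[OF g that] norm_triangle_ineq[of "f x" "g x"]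
      by (simp add: algebra_simps)
    then have "\<exists>K. \<forall>x\<in>S. cmod ((f + g) x) \<le> K * \<nu> x" by blast
    then show ?thesis using f g by (auto simp: cdual_def algebra_simps)
  qed
  have mul: "(\<lambda>x. c * f x) \<in> cdual" if f: "f \<in> cdual" for f c
  proof -
    have "cmod (c * f x) \<le> (cmod c * cnorm f) * \<nu> x" if "x \<in> S" for x
      using cnorm_bound[OF f that] by (simp add: norm_mult mult.assoc mult_left_mono)
    then have "\<exists>K. \<forall>x\<in>S. cmod (c * f x) \<le> K * \<nu> x" by blast
    then show ?thesis using f by (auto simp: cdual_def algebra_simps)
  qed
  have sca: "r *\<^sub>R f = (\<lambda>x. complex_of_real r * f x)" for r and f :: "'v \<Rightarrow> complex"
    by (simp add: fun_eq_iff scaleR_conv_of_real)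
  have zero: "0 \<in> cdual" by (auto simp: cdual_def intro: exI[of _ 0])
  show "subspace cdual" using add mul zero by (auto simp: subspace_def sca)
  show "(\<lambda>x. c * f x) \<in> cdual" if "f \<in> cdual" for f c using mul that .
  show "cnorm (f + g) \<le> cnorm f + cnorm g" if f: "f \<in> cdual" and g: "g \<in> cdual" for f g
    by (rule cnorm_least)
      (use cnorm_upper[OF f] cnorm_upper[OF g] in \<open>auto intro: norm_triangle_le add_mono\<close>)
  show "cnorm (\<lambda>x. c * f x) = cmod c * cnorm f" if f: "f \<in> cdual" for f c
  proof (rule antisym)
    show "cnorm (\<lambda>x. c * f x) \<le> cmod c * cnorm f"
      by (rule cnorm_least) (auto simp: norm_mult cnorm_upper[OF f] mult_left_mono)
    show "cmod c * cnorm f \<le> cnorm (\<lambda>x. c * f x)"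
    proof (cases "c = 0")
      case True
      then show ?thesis using cnorm_nonneg[OF mul[OF f, of 0]] by simp
    next
      case False
      have "cnorm f \<le> inverse (cmod c) * cnorm (\<lambda>x. c * f x)"
      proof (rule cnorm_least)
        fix x assume x: "x \<in> S" "\<nu> x \<le> 1"
        have "cmod (c * f x) \<le> cnorm (\<lambda>x. c * f x)" by (rule cnorm_upper[OF mul[OF f] x])
        then show "cmod (f x) \<le> inverse (cmod c) * cnorm (\<lambda>x. c * f x)"
          using False by (simp add: norm_mult field_simps)
      qed
      then show ?thesis using False by (simp add: field_simps)
    qed
  qed
qed (auto simp: fun_eq_iff algebra_simps scaleR_conv_of_real)

text \<open>The complex functional is \<open>g x - i g (i x)\<close>. Rotating \<open>x\<close> by
  the phase of \<open>f x\<close> makes the value real, so the one-sided bound on \<open>g\<close>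
  controls the modulus.\<close>

lemma complexify_functional:
  assumes g: "linear_functional_on S g" and K: "K \<ge> 0" and le: "\<And>x. x \<in> S \<Longrightarrow> g x \<le> K * \<nu> x"
  obtains f where "f \<in> cdual" "cnorm f \<le> K" "\<And>x. x \<in> S \<Longrightarrow> Re (f x) = g x"
proof -
  define f where "f = (\<lambda>x. Complex (g x) (- g (sc \<i> x)))"
  have gadd: "g (x + y) = g x + g y" if "x \<in> S" "y \<in> S" for x y
    using g that by (simp add: linear_functional_on_def)
  have gscale: "g (r *\<^sub>R x) = r * g x" if "x \<in> S" for x r
    using g that by (simp add: linear_functional_on_def)
  have sc_split: "sc c x = Re c *\<^sub>R x + Im c *\<^sub>R sc \<i> x" if x: "x \<in> S" for c x
  proof -
    have "sc c x = sc (complex_of_real (Re c) + complex_of_real (Im c) * \<i>) x"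
      by (metis complex_eq mult.commute)
    also have "\<dots> = Re c *\<^sub>R x + Im c *\<^sub>R sc \<i> x"
      by (simp add: sc_add_left[OF x] sc_sc[OF x] sc_of_real[OF x] sc_of_real[OF sc_closed[OF x]])
    finally show ?thesis .
  qed
  have gsc: "g (sc c x) = Re c * g x + Im c * g (sc \<i> x)" if x: "x \<in> S" for c x
    using sc_split[OF x, of c] gadd gscale x sc_closed subspace_scale[OF subspace] by metis
  have fsc: "f (sc c x) = c * f x" if x: "x \<in> S" for c x
    using gsc[OF x, of c] gsc[OF x, of "\<i> * c"] sc_sc[OF x, of \<i> c]
    by (simp add: f_def complex_eq_iff algebra_simps)
  have bound: "cmod (f x) \<le> K * \<nu> x" if x: "x \<in> S" for x
  proof -
    obtain u where u1: "cmod u = 1" and u2: "u * f x = of_real (cmod (f x))"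
      by (rule obtain_phase)
    have "cmod (f x) = Re (f (sc u x))" using fsc[OF x, of u] u2 by simp
    also have "\<dots> = g (sc u x)" by (simp add: f_def)
    also have "\<dots> \<le> K * \<nu> x" using le[OF sc_closed[OF x, of u]] seminorm_sc[OF x] u1 by simp
    finally show ?thesis .
  qed
  have "f \<in> cdual"
  proof -
    have "f (x + y) = f x + f y" if "x \<in> S" "y \<in> S" for x y
      using that by (simp add: f_def complex_eq_iff gadd sc_add sc_closed)
    then show ?thesis using bound fsc unfolding cdual_def by blast
  qed
  moreover have "cnorm f \<le> K" using K bound by (rule cnorm_le)
  ultimately show thesis using that by (auto simp: f_def)
qed

end

section \<open>The multiplier unitization and its biduals\<close>

locale complex_algebra =
  fixes cs :: "complex \<Rightarrow> 'a::{real_normed_algebra,banach} \<Rightarrow> 'a"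
  assumes complex_banach_algebra: "complex_banach_algebra cs"
begin

lemma
  shows cs_add: "cs c (x + y) = cs c x + cs c y"
    and cs_add_left: "cs (c + d) x = cs c x + cs d x"
    and cs_cs: "cs (c * d) x = cs c (cs d x)"
    and cs_of_real: "cs (complex_of_real r) x = r *\<^sub>R x"
    and norm_cs: "norm (cs c x) = cmod c * norm x"
  using complex_banach_algebra unfolding complex_banach_algebra_def by blast+

lemma cs_mult_left: "cs c x * y = cs c (x * y)" and cs_mult_right: "x * cs c y = cs c (x * y)"
  by (rule sym; use complex_banach_algebra in \<open>unfold complex_banach_algebra_def, blast\<close>)+

lemma cs_0 [simp]: "cs c 0 = 0"
  using norm_cs[of c 0] by simp

lemma cs_zero [simp]: "cs 0 x = 0"
  using norm_cs[of 0 x] by simp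

lemma cs_one [simp]: "cs 1 x = x"
  using cs_of_real[of 1 x] by simp

lemma cs_two: "cs 2 x = 2 *\<^sub>R x"
  using cs_of_real[of 2 x] by simp

lemma cs_scaleR: "cs c (r *\<^sub>R x) = r *\<^sub>R cs c x"
  using cs_cs[of c "of_real r" x] cs_cs[of "of_real r" c x] by (simp add: cs_of_real mult.commute)

section \<open>Left multiplication operators and the norm of the unitization\<close>

definition csX :: "complex \<Rightarrow> 'a \<times> complex \<Rightarrow> 'a \<times> complex" where
  "csX c x = (cs c (fst x), c * snd x)"

definition act :: "'a \<times> complex \<Rightarrow> 'a \<Rightarrow> 'a" where
  "act x c = fst x * c + cs (snd x) c"

lemma act_add: "act (x + y) c = act x c + act y c"
  by (simp add: act_def cs_add_left algebra_simps)

lemma act_csX: "act (csX d x) c = cs d (act x c)"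
  by (simp add: act_def csX_def cs_add cs_mult_left cs_cs)

lemma act_scaleR: "act x (r *\<^sub>R c) = r *\<^sub>R act x c"
  by (simp add: act_def cs_scaleR scaleR_add_right)

lemma norm_act_le: "norm (act x c) \<le> (norm (fst x) + cmod (snd x)) * norm c"
  unfolding act_def
  by (rule norm_triangle_le) (simp add: norm_cs distrib_right norm_mult_ineq)

lemma unorm_eq: "unorm cs x = Sup {norm (act x c) |c. norm c \<le> 1}"
  by (simp add: unorm_def act_def)

lemma unorm_upper: "norm c \<le> 1 \<Longrightarrow> norm (act x c) \<le> unorm cs x"
  unfolding unorm_eq
proof (rule cSup_upper)
  have "norm (act x c) \<le> norm (fst x) + cmod (snd x)" if "norm c \<le> 1" for c
    using norm_act_le[of x c] that by (meson add_nonneg_nonneg mult_left_le norm_ge_zero order_trans)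
  then show "bdd_above {norm (act x c) |c. norm c \<le> 1}" by (auto intro!: bdd_aboveI)
qed auto

lemma unorm_least: "(\<And>c. norm c \<le> 1 \<Longrightarrow> norm (act x c) \<le> K) \<Longrightarrow> unorm cs x \<le> K"
  unfolding unorm_eq by (rule cSup_least) (auto intro: exI[of _ 0])

lemma unorm_nonneg: "0 \<le> unorm cs x"
  by (rule order_trans[OF norm_ge_zero unorm_upper[of 0 x]]) simp

lemma norm_act_unorm: "norm (act x c) \<le> unorm cs x * norm c"
proof (cases "c = 0")
  case True
  then show ?thesis by (simp add: act_def)
next
  case False
  have "norm (act x (inverse (norm c) *\<^sub>R c)) \<le> unorm cs x"
    by (rule unorm_upper) (use False in simp)
  then show ?thesis using False by (simp add: act_scaleR field_simps)
qed

lemma complex_seminormed_unorm: "complex_seminormed UNIV csX (unorm cs)"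
proof
  show "unorm cs (x + y) \<le> unorm cs x + unorm cs y" for x y
    by (rule unorm_least) (auto simp: act_add intro!: norm_triangle_le add_mono unorm_upper)
  have le: "unorm cs (csX c x) \<le> cmod c * unorm cs x" for c x
    by (rule unorm_least) (auto simp: act_csX norm_cs intro!: mult_left_mono unorm_upper)
  show "unorm cs (csX c x) = cmod c * unorm cs x" for c x
  proof (cases "c = 0")
    case True
    then show ?thesis using le[of 0 x] unorm_nonneg[of "csX 0 x"] by simp
  next
    case False
    have "csX (inverse c) (csX c x) = x" using False
      by (simp add: csX_def cs_cs[symmetric] mult.assoc[symmetric])
    then have "unorm cs x \<le> cmod (inverse c) * unorm cs (csX c x)" using le[of "inverse c" "csX c x"] by simp
    then have "cmod c * unorm cs x \<le> unorm cs (csX c x)" using False by (simp add: norm_inverse inverse_eq_divide[of "cmod c"] pos_le_divide_eq mult.commute)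
    then show ?thesis using le[of c x] by simp
  qed
qed (simp_all add: csX_def prod_eq_iff cs_add cs_add_left cs_cs cs_of_real distrib_left distrib_right
    scaleR_conv_of_real[where 'a = complex] mult.assoc)

text \<open>The rewrites turn the generic dual and its norm into the given \<open>dual1\<close> and
  \<open>dnorm1\<close>; the next two interpretations climb to \<open>dual2\<close> and
  \<open>dual3\<close> in the same way.\<close>

sublocale X: complex_seminormed UNIV csX "unorm cs"
  rewrites "complex_seminormed.cdual UNIV csX (unorm cs) = dual1 cs"
    and "complex_seminormed.cnorm UNIV (unorm cs) = dnorm1 cs"
proof -
  show i: "complex_seminormed UNIV csX (unorm cs)" by (rule complex_seminormed_unorm)
  show "complex_seminormed.cdual UNIV csX (unorm cs) = dual1 cs"
    by (simp add: complex_seminormed.cdual_def[OF i] dual1_def csX_def plus_prod_def)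
  show "complex_seminormed.cnorm UNIV (unorm cs) = dnorm1 cs"
    by (simp add: complex_seminormed.cnorm_def[OF i] dnorm1_def fun_eq_iff)
qed

sublocale D: complex_seminormed "dual1 cs" "\<lambda>c f x. c * f x" "dnorm1 cs"
  rewrites "complex_seminormed.cdual (dual1 cs) (\<lambda>c f x. c * f x) (dnorm1 cs) = dual2 cs"
    and "complex_seminormed.cnorm (dual1 cs) (dnorm1 cs) = bnorm cs"
proof -
  show i: "complex_seminormed (dual1 cs) (\<lambda>c f x. c * f x) (dnorm1 cs)"
    by (rule X.complex_seminormed_dual)
  show "complex_seminormed.cdual (dual1 cs) (\<lambda>c f x. c * f x) (dnorm1 cs) = dual2 cs"
    by (simp add: complex_seminormed.cdual_def[OF i] dual2_def plus_fun_def)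
  show "complex_seminormed.cnorm (dual1 cs) (dnorm1 cs) = bnorm cs"
    by (simp add: complex_seminormed.cnorm_def[OF i] bnorm_def fun_eq_iff)
qed

sublocale B: complex_seminormed "dual2 cs" "\<lambda>c P f. c * P f" "bnorm cs"
  rewrites "complex_seminormed.cdual (dual2 cs) (\<lambda>c f x. c * f x) (bnorm cs) = dual3 cs"
    and "complex_seminormed.cnorm (dual2 cs) (bnorm cs) = tnorm cs"
proof -
  show i: "complex_seminormed (dual2 cs) (\<lambda>c P f. c * P f) (bnorm cs)"
    by (rule D.complex_seminormed_dual)
  show "complex_seminormed.cdual (dual2 cs) (\<lambda>c P f. c * P f) (bnorm cs) = dual3 cs"
    by (simp add: complex_seminormed.cdual_def[OF i] dual3_def plus_fun_def)
  show "complex_seminormed.cnorm (dual2 cs) (bnorm cs) = tnorm cs"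
    by (simp add: complex_seminormed.cnorm_def[OF i] tnorm_def fun_eq_iff)
qed

lemma unorm_one_le: "unorm cs (0, 1) \<le> 1"
  by (rule unorm_least) (simp add: act_def)

lemma unorm_embed_le: "unorm cs (a, 0) \<le> norm a"
  by (rule unorm_least, rule order_trans[OF norm_act_le]) (simp add: mult_left_le)

lemma dual1_additive: "f \<in> dual1 cs \<Longrightarrow> f (x + y) = f x + f y"
  using X.cdual_add by simp

lemma dual1_csX: "f \<in> dual1 cs \<Longrightarrow> f (csX c x) = c * f x"
  using X.cdual_sc by simp

lemma canon_dual2: "canon x \<in> dual2 cs"
proof -
  have "\<forall>f\<in>dual1 cs. cmod (canon x f) \<le> unorm cs x * dnorm1 cs f"
    using X.cnorm_bound[of _ x] by (simp add: canon_def mult.commute)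
  then have "\<exists>K. \<forall>f\<in>dual1 cs. cmod (canon x f) \<le> K * dnorm1 cs f" by blast
  then show ?thesis by (simp add: dual2_def canon_def)
qed

lemma bnorm_canon_le: "bnorm cs (canon x) \<le> unorm cs x"
  by (rule D.cnorm_le) (use X.cnorm_bound in \<open>auto simp: unorm_nonneg canon_def mult.commute\<close>)

lemma canon_Aperpperp: "canon (a, 0) \<in> Aperpperp cs"
  using canon_dual2 by (simp add: Aperpperp_def canon_def)

text \<open>Bidual elements are total functions that matter only on \<open>dual1\<close>; identities
  valid there, such as those for the M-projection, carry over to norms in this way.\<close>

lemma bnorm_cong: "(\<And>f. f \<in> dual1 cs \<Longrightarrow> P f = Q f) \<Longrightarrow> bnorm cs P = bnorm cs Q"
  unfolding bnorm_def by (intro arg_cong[where f = Sup] Collect_cong ex_cong1) auto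

end

section \<open>A Helly principle\<close>

text \<open>Splits a separating functional on a product into one functional for each of finitely
  many coordinates.\<close>

lemma linear_functional_on_coordinates:
  fixes k :: "('i \<Rightarrow> 'v::real_vector) \<Rightarrow> real"
  assumes k: "linear_functional_on UNIV k" and F: "finite F"
  shows "k (\<lambda>i. if i \<in> F then w i else 0) = (\<Sum>i\<in>F. k (\<lambda>j. if j = i then w i else 0))"
  using F
proof (induction F rule: finite_induct)
  case empty
  have "(\<lambda>i. if i \<in> {} then w i else 0) = (0 :: real) *\<^sub>R w" by (simp add: fun_eq_iff)
  moreover have "k ((0 :: real) *\<^sub>R w) = 0 * k w" using k unfolding linear_functional_on_def by blast
  ultimately show ?case by simp
next
  case (insert i F)
  have add: "k (u + v) = k u + k v" for u v using k by (simp add: linear_functional_on_def)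
  have "(\<lambda>j. if j \<in> insert i F then w j else 0) =
      (\<lambda>j. if j = i then w i else 0) + (\<lambda>j. if j \<in> F then w j else 0)"
    using insert.hyps by (auto simp: fun_eq_iff)
  then show ?case using insert.IH by (simp only: add sum.insert[OF insert.hyps])
qed

lemma real_functional_on_complex:
  assumes k: "linear_functional_on UNIV (k :: complex \<Rightarrow> real)"
  shows "k z = Re (Complex (k 1) (- k \<i>) * z)"
proof -
  have "z = Re z *\<^sub>R 1 + Im z *\<^sub>R \<i>" by (simp add: complex_eq_iff)
  then have "k z = Re z * k 1 + Im z * k \<i>"
    using k unfolding linear_functional_on_def by (metis UNIV_I)
  then show ?thesis by simp
qed

context complex_algebra
begin

lemma dual1_combination:
  assumes "finite F" "F \<subseteq> dual1 cs"
  shows "(\<lambda>x. \<Sum>f\<in>F. c f * f x) \<in> dual1 cs"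
    and "P \<in> dual2 cs \<Longrightarrow> P (\<lambda>x. \<Sum>f\<in>F. c f * f x) = (\<Sum>f\<in>F. c f * P f)"
proof -
  have "(\<lambda>x. \<Sum>f\<in>F. c f * f x) \<in> dual1 cs \<and>
    (P \<in> dual2 cs \<longrightarrow> P (\<lambda>x. \<Sum>f\<in>F. c f * f x) = (\<Sum>f\<in>F. c f * P f))"
    using assms
  proof (induction F rule: finite_induct)
    case empty
    have z: "(\<lambda>x. 0) \<in> dual1 cs" using subspace_0[OF D.subspace] by (simp add: zero_fun_def)
    have "P (\<lambda>x. 0) = 0" if "P \<in> dual2 cs" using D.cdual_sc[OF that z, of 0] by simp
    then show ?case using z by simp
  next
    case (insert f F)
    have f: "(\<lambda>x. c f * f x) \<in> dual1 cs" "f \<in> dual1 cs" using insert D.sc_closed by auto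
    have eq: "(\<lambda>x. \<Sum>f\<in>insert f F. c f * f x) = (\<lambda>x. c f * f x) + (\<lambda>x. \<Sum>f\<in>F. c f * f x)"
      using insert by (simp add: fun_eq_iff)
    have IH: "(\<lambda>x. \<Sum>f\<in>F. c f * f x) \<in> dual1 cs"
      "P \<in> dual2 cs \<longrightarrow> P (\<lambda>x. \<Sum>f\<in>F. c f * f x) = (\<Sum>f\<in>F. c f * P f)"
      using insert by auto
    show ?case unfolding eq
      using insert.hyps IH f subspace_add[OF D.subspace] D.cdual_add[of P] D.cdual_sc[of P f "c f"] by simp
  qed
  then show "(\<lambda>x. \<Sum>f\<in>F. c f * f x) \<in> dual1 cs"
    and "P \<in> dual2 cs \<Longrightarrow> P (\<lambda>x. \<Sum>f\<in>F. c f * f x) = (\<Sum>f\<in>F. c f * P f)" by auto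
qed

lemma Aperpperp_dual2: "P \<in> Aperpperp cs \<Longrightarrow> P \<in> dual2 cs"
  by (simp add: Aperpperp_def)

text \<open>The dual norm of a weighted maximum norm is a weighted sum of dual norms. Rotating
  \<open>u\<close> and \<open>v\<close> by phases makes both values real and nonnegative at
  once.\<close>

lemma dnorm1_max_bound:
  assumes G: "G \<in> dual1 cs" and H: "H \<in> dual1 cs" and r: "r > 0" "s > 0"
    and le: "\<And>u v. Re (G u) + Re (H v) \<le> max (unorm cs u / r) (unorm cs v / s)"
  shows "r * dnorm1 cs G + s * dnorm1 cs H \<le> 1"
proof -
  have *: "r * cmod (G u) + s * cmod (H v) \<le> 1" if "unorm cs u \<le> 1" "unorm cs v \<le> 1" for u v
  proof -
    obtain \<alpha> where \<alpha>: "cmod \<alpha> = 1" "\<alpha> * G u = of_real (cmod (G u))" by (rule obtain_phase)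
    obtain \<beta> where \<beta>: "cmod \<beta> = 1" "\<beta> * H v = of_real (cmod (H v))" by (rule obtain_phase)
    let ?u = "csX (of_real r * \<alpha>) u" and ?v = "csX (of_real s * \<beta>) v"
    have "G ?u = of_real r * of_real (cmod (G u))" "H ?v = of_real s * of_real (cmod (H v))"
      using X.cdual_sc[OF G] X.cdual_sc[OF H] \<alpha> \<beta> by (simp_all add: mult.assoc)
    moreover have "unorm cs ?u / r \<le> 1" "unorm cs ?v / s \<le> 1"
      using that r \<alpha> \<beta> by (simp_all add: X.seminorm_sc norm_mult)
    ultimately show ?thesis using le[of ?u ?v] by simp
  qed
  \<comment> \<open>The supremum over \<open>u\<close> is taken with \<open>v\<close> fixed, then
    the supremum over \<open>v\<close>.\<close>
  have "dnorm1 cs G \<le> (1 - s * cmod (H v)) / r" if "unorm cs v \<le> 1" for v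
    by (rule X.cnorm_least) (use *[OF _ that] r in \<open>simp add: field_simps\<close>)
  then have "dnorm1 cs H \<le> (1 - r * dnorm1 cs G) / s"
    by (intro X.cnorm_least) (use r in \<open>simp add: field_simps\<close>)
  then show ?thesis using r by (simp add: field_simps)
qed

text \<open>Separation takes place in \<open>A\<^sup>1 \<times> A\<^sup>1 \<times> \<complex>\<^sup>F\<close>, with a large weight on the last factor. A functional
  that is constant on the translate of \<open>A\<close> in question restricts to \<open>A\<close> as an element of the annihilator of
  \<open>A\<close>, where \<open>P\<close> vanishes.\<close>
lemma helly:
  assumes P: "P \<in> Aperpperp cs" and r: "r > 0" "s > 0" and e: "e > 0"
    and x: "bnorm cs (canon x - P) \<le> r" and y: "bnorm cs (canon y - P) \<le> s"
    and F: "finite F" "F \<subseteq> dual1 cs"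
  obtains a where "unorm cs (x - (a, 0)) \<le> r * (1 + e)" "unorm cs (y - (a, 0)) \<le> s * (1 + e)"
    "\<And>f. f \<in> F \<Longrightarrow> cmod (f (a, 0) - P f) < e"
proof (rule ccontr)
  assume no: "\<not> thesis"
  \<comment> \<open>The weight is such that \<open>N (\<kappa> a) < 1 + e\<close> forces the total
    error over \<open>F\<close> below \<open>(1 + e) / M = e\<close>.\<close>
  define M where "M = (1 + e) / e"
  have M: "M > 0" using e by (simp add: M_def)
  define N :: "('a \<times> complex) \<times> ('a \<times> complex) \<times> (('a \<times> complex \<Rightarrow> complex) \<Rightarrow> complex) \<Rightarrow> real"
    where "N = (\<lambda>z. max (unorm cs (fst z) / r) (unorm cs (fst (snd z)) / s) + M * (\<Sum>f\<in>F. cmod (snd (snd z) f)))"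
  \<comment> \<open>Affine in \<open>a\<close>. As no \<open>a\<close> is suitable, \<open>N\<close>
    is at least \<open>1 + e\<close> on the whole range.\<close>
  define \<kappa> where "\<kappa> = (\<lambda>a. (x - (a, 0 :: complex), y - (a, 0 :: complex),
    (\<lambda>f. if f \<in> F then P f - f (a, 0) else 0)))"
  have Nsub: "sublinear_on UNIV N"
  proof (rule sublinear_onI)
    fix z z' :: "('a \<times> complex) \<times> ('a \<times> complex) \<times> (('a \<times> complex \<Rightarrow> complex) \<Rightarrow> complex)"
    have "unorm cs (fst z + fst z') / r \<le> unorm cs (fst z) / r + unorm cs (fst z') / r"
      "unorm cs (fst (snd z) + fst (snd z')) / s \<le> unorm cs (fst (snd z)) / s + unorm cs (fst (snd z')) / s"
      using r X.triangle by (simp_all add: add_divide_distrib[symmetric] divide_right_mono)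
    moreover have "M * (\<Sum>f\<in>F. cmod (snd (snd (z + z')) f)) \<le>
        M * (\<Sum>f\<in>F. cmod (snd (snd z) f)) + M * (\<Sum>f\<in>F. cmod (snd (snd z') f))"
      unfolding distrib_left[symmetric] sum.distrib[symmetric]
      using M by (intro mult_left_mono sum_mono) (auto simp: norm_triangle_ineq)
    ultimately show "N (z + z') \<le> N z + N z'" by (simp add: N_def)
  next
    fix t :: real and z :: "('a \<times> complex) \<times> ('a \<times> complex) \<times> (('a \<times> complex \<Rightarrow> complex) \<Rightarrow> complex)"
    assume t: "t > 0"
    have "max (t * A) (t * B) = t * max A B" for A B :: real using t by (simp add: max_mult_distrib_left)
    then show "N (t *\<^sub>R z) \<le> t * N z"
      using t by (simp add: N_def X.seminorm_scaleR sum_distrib_left distrib_left mult.left_commute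
          flip: times_divide_eq_right)
  qed (simp_all add: N_def X.seminorm_zero)
  have "1 + e \<le> N (\<kappa> a)" for a
  proof (rule ccontr)
    assume "\<not> 1 + e \<le> N (\<kappa> a)"
    moreover have S0: "0 \<le> (\<Sum>f\<in>F. cmod (P f - f (a, 0)))" by (intro sum_nonneg) auto
    moreover have Neq: "N (\<kappa> a) = max (unorm cs (x - (a, 0)) / r) (unorm cs (y - (a, 0)) / s)
        + M * (\<Sum>f\<in>F. cmod (P f - f (a, 0)))"
      by (simp add: N_def \<kappa>_def)
    moreover have "0 \<le> unorm cs (x - (a, 0)) / r" using r by (simp add: unorm_nonneg)
    moreover have "0 \<le> M * (\<Sum>f\<in>F. cmod (P f - f (a, 0)))" using M S0 by simp
    ultimately have h: "unorm cs (x - (a, 0)) / r < 1 + e" "unorm cs (y - (a, 0)) / s < 1 + e"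
      "M * (\<Sum>f\<in>F. cmod (P f - f (a, 0))) < 1 + e"
      by linarith+
    have "cmod (f (a, 0) - P f) < e" if "f \<in> F" for f
    proof -
      have "cmod (P f - f (a, 0)) \<le> (\<Sum>f\<in>F. cmod (P f - f (a, 0)))"
        using that F by (intro member_le_sum) auto
      also have "\<dots> < e"
      proof -
        have "(1 + e) * (\<Sum>f\<in>F. cmod (P f - f (a, 0))) < (1 + e) * e"
          using h(3) e by (simp add: M_def pos_divide_less_eq)
        then show ?thesis using e by simp
      qed
      finally show ?thesis by (simp add: norm_minus_commute)
    qed
    then show False using no that[of a] h(1,2) r by (simp add: field_simps)
  qed
  moreover have "convex (range \<kappa>)"
  proof (rule convexI)
    fix z z' and p q :: real assume zz: "z \<in> range \<kappa>" "z' \<in> range \<kappa>" and pq: "p \<ge> 0" "q \<ge> 0" "p + q = 1"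
    then obtain a b where ab: "z = \<kappa> a" "z' = \<kappa> b" by auto
    have f: "f (p *\<^sub>R a + q *\<^sub>R b, 0) = p *\<^sub>R f (a, 0) + q *\<^sub>R f (b, 0)" if "f \<in> F" for f
    proof -
      have "f \<in> dual1 cs" using that F by auto
      then have "f (p *\<^sub>R (a, 0) + q *\<^sub>R (b, 0)) = p *\<^sub>R f (a, 0) + q *\<^sub>R f (b, 0)"
        by (simp only: dual1_additive X.cdual_scaleR UNIV_I)
      then show ?thesis by simp
    qed
    have "p *\<^sub>R z + q *\<^sub>R z' = \<kappa> (p *\<^sub>R a + q *\<^sub>R b)"
      unfolding ab \<kappa>_def
      by (auto simp: fun_eq_iff f scaleR_diff_right prod_eq_iff) 
         (use pq in \<open>simp_all add: scaleR_add_left[symmetric]\<close>)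
    then show "p *\<^sub>R z + q *\<^sub>R z' \<in> range \<kappa>" by simp
  qed
  ultimately obtain \<phi> where \<phi>: "linear_functional_on UNIV \<phi>" "\<And>z. \<phi> z \<le> N z" "\<And>a. 1 + e \<le> \<phi> (\<kappa> a)"
    by (rule_tac convex_separation[of UNIV N "range \<kappa>" "1 + e"]) (use Nsub in auto)
  have add: "\<phi> (u + v) = \<phi> u + \<phi> v" and scale: "\<phi> (t *\<^sub>R u) = t * \<phi> u" for u v t
    using \<phi>(1) unfolding linear_functional_on_def by blast+
  have "linear_functional_on UNIV (\<lambda>u. \<phi> (u, 0, 0))" "linear_functional_on UNIV (\<lambda>v. \<phi> (0, v, 0))"
    and kl: "linear_functional_on UNIV (\<lambda>w. \<phi> (0, 0, w))"
    unfolding linear_functional_on_def by (auto simp flip: add scale)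
  moreover have "\<phi> (u, 0, 0) \<le> (1 / r) * unorm cs u" "\<phi> (0, u, 0) \<le> (1 / s) * unorm cs u" for u
    using \<phi>(2)[of "(u, 0, 0)"] \<phi>(2)[of "(0, u, 0)"] r unorm_nonneg[of u] by (simp_all add: N_def X.seminorm_zero)
  ultimately obtain G H where G: "G \<in> dual1 cs" "\<And>u. Re (G u) = \<phi> (u, 0, 0)"
    and H: "H \<in> dual1 cs" "\<And>v. Re (H v) = \<phi> (0, v, 0)"
    using X.complexify_functional[of "\<lambda>u. \<phi> (u, 0, 0)" "1 / r"]
      X.complexify_functional[of "\<lambda>v. \<phi> (0, v, 0)" "1 / s"] r by (metis UNIV_I divide_nonneg_pos less_imp_le zero_le_one)
  \<comment> \<open>On the coordinate \<open>f\<close>, \<open>\<phi>\<close> is the real part of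
    multiplication by a complex number \<open>c f\<close>.\<close>
  define \<theta> where "\<theta> = (\<lambda>f z. \<phi> (0, 0, (\<lambda>g. if g = f then z else 0)))"
  define c where "c = (\<lambda>f. Complex (\<theta> f 1) (- \<theta> f \<i>))"
  have c: "\<phi> (0, 0, (\<lambda>f. if f \<in> F then w f else 0)) = (\<Sum>f\<in>F. Re (c f * w f))" for w
  proof -
    have "linear_functional_on UNIV (\<theta> f)" for f
      unfolding linear_functional_on_def
    proof (intro conjI ballI allI)
      fix z z' :: complex and t :: real
      let ?\<delta> = "\<lambda>z g. if g = f then z else 0"
      have "?\<delta> (z + z') = ?\<delta> z + ?\<delta> z'" by (auto simp: fun_eq_iff)
      then show "\<theta> f (z + z') = \<theta> f z + \<theta> f z'"
        using add[of "(0, 0, ?\<delta> z)" "(0, 0, ?\<delta> z')"] by (simp add: \<theta>_def)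
      have "?\<delta> (t *\<^sub>R z) = t *\<^sub>R ?\<delta> z" by (auto simp: fun_eq_iff)
      then show "\<theta> f (t *\<^sub>R z) = t * \<theta> f z"
        using scale[of t "(0, 0, ?\<delta> z)"] by (simp add: \<theta>_def)
    qed
    then have "\<theta> f (w f) = Re (c f * w f)" for f unfolding c_def by (rule real_functional_on_complex)
    moreover have "\<phi> (0, 0, (\<lambda>f. if f \<in> F then w f else 0)) = (\<Sum>f\<in>F. \<theta> f (w f))"
      unfolding \<theta>_def by (rule linear_functional_on_coordinates[OF kl F(1)])
    ultimately show ?thesis by simp
  qed
  have split: "\<phi> (u, v, w) = Re (G u) + Re (H v) + \<phi> (0, 0, w)" for u v w
    using add[of "(u, 0, 0)" "(0, v, 0)"] add[of "(u, v, 0)" "(0, 0, w)"] by (simp add: G H)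
  \<comment> \<open>Collects, with opposite sign, the part of \<open>\<phi> (\<kappa> a)\<close>
    that depends on \<open>a\<close>.\<close>
  define L where "L = G + H + (\<lambda>x. \<Sum>f\<in>F. c f * f x)"
  have L: "L \<in> dual1 cs"
    unfolding L_def using G H dual1_combination(1)[OF F] by (intro subspace_add[OF D.subspace])
  define A where "A = Re (G x) + Re (H y) + (\<Sum>f\<in>F. Re (c f * P f))"
  have A: "\<phi> (\<kappa> a) = A - Re (L (a, 0))" for a
  proof -
    have "\<phi> (\<kappa> a) = Re (G (x - (a, 0))) + Re (H (y - (a, 0))) + (\<Sum>f\<in>F. Re (c f * (P f - f (a, 0))))"
      unfolding \<kappa>_def by (subst split) (simp only: c)
    also have "(\<Sum>f\<in>F. Re (c f * (P f - f (a, 0)))) = (\<Sum>f\<in>F. Re (c f * P f)) - (\<Sum>f\<in>F. Re (c f * f (a, 0)))"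
      by (simp only: right_diff_distrib minus_complex.sel sum_subtractf)
    finally show ?thesis
      using X.cdual_diff[OF G(1), of x "(a, 0)"] X.cdual_diff[OF H(1), of y "(a, 0)"]
      by (simp add: A_def L_def Re_sum del: times_complex.sel)
  qed
  \<comment> \<open>\<open>\<phi> (\<kappa> a)\<close> is at least \<open>1 + e\<close> for all
    \<open>a\<close>; if \<open>L\<close> were nonzero on \<open>A\<close>, a multiple of
    \<open>a\<close> would bring it to 0.\<close>
  have L0: "L (a, 0) = 0" for a
  proof (rule ccontr)
    assume ne: "L (a, 0) \<noteq> 0"
    have "L (csX (of_real A / L (a, 0)) (a, 0)) = of_real A" using ne by (simp add: dual1_csX[OF L])
    then have "L (cs (of_real A / L (a, 0)) a, 0) = of_real A" by (simp add: csX_def)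
    then show False using \<phi>(3)[of "cs (of_real A / L (a, 0)) a"] e by (simp add: A)
  qed
  have P2: "P \<in> dual2 cs" using P by (rule Aperpperp_dual2)
  have "P L = P G + P H + (\<Sum>f\<in>F. c f * P f)"
    unfolding L_def using G H dual1_combination[OF F] P2
    by (simp add: D.cdual_add subspace_add[OF D.subspace])
  moreover have "P L = 0" using P L L0 by (simp add: Aperpperp_def)
  ultimately have "Re (P G + P H + (\<Sum>f\<in>F. c f * P f)) = 0" by simp
  then have "Re (P G) + Re (P H) + (\<Sum>f\<in>F. Re (c f * P f)) = 0"
    by (simp only: plus_complex.sel Re_sum)
  \<comment> \<open>Subtracting \<open>Re (P L) = 0\<close> from the constant \<open>A\<close>
    replaces \<open>G x\<close> and \<open>H y\<close> by the values of \<open>canon x - P\<close>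
    and \<open>canon y - P\<close>, and cancels the terms from \<open>F\<close>.\<close>
  then have "1 + e \<le> Re ((canon x - P) G) + Re ((canon y - P) H)"
    using \<phi>(3)[of 0] A[of 0] L0[of 0] by (simp add: A_def canon_def del: times_complex.sel)
  also have "\<dots> \<le> cmod ((canon x - P) G) + cmod ((canon y - P) H)"
    by (intro add_mono complex_Re_le_cmod)
  also have "\<dots> \<le> r * dnorm1 cs G + s * dnorm1 cs H"
  proof -
    have "cmod ((canon z - P) K) \<le> t * dnorm1 cs K"
      if "bnorm cs (canon z - P) \<le> t" "K \<in> dual1 cs" for z t K
      using D.cnorm_bound[OF subspace_diff[OF B.subspace canon_dual2 P2] that(2)]
        mult_right_mono[OF that(1) X.cnorm_nonneg[OF that(2)]] by (rule order_trans)
    then show ?thesis using x y G H by (intro add_mono)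
  qed
  also have "\<dots> \<le> 1"
  proof (rule dnorm1_max_bound[OF G(1) H(1) r])
    fix u v
    show "Re (G u) + Re (H v) \<le> max (unorm cs u / r) (unorm cs v / s)"
      using \<phi>(2)[of "(u, v, 0)"] add[of "(u, 0, 0)" "(0, v, 0)"] by (simp add: G H N_def)
  qed
  finally show False using e by simp
qed

end

section \<open>M-ideals and the density theorems\<close>

text \<open>The M-projection is fixed as a parameter. Its algebraic laws are stated at points of
  \<open>dual1\<close>, where bidual elements are compared.\<close>

locale M_ideal_algebra = complex_algebra cs
  for cs :: "complex \<Rightarrow> 'a::{real_normed_algebra,banach} \<Rightarrow> 'a" +
  fixes Pr :: "(('a \<times> complex \<Rightarrow> complex) \<Rightarrow> complex) \<Rightarrow> ('a \<times> complex \<Rightarrow> complex) \<Rightarrow> complex"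
  assumes approx_unital: "cai_in (UNIV :: 'a set)"
    and Pr_Aperpperp: "P \<in> dual2 cs \<Longrightarrow> Pr P \<in> Aperpperp cs"
    and Pr_add: "P \<in> dual2 cs \<Longrightarrow> Q \<in> dual2 cs \<Longrightarrow> f \<in> dual1 cs \<Longrightarrow>
      Pr (\<lambda>g. P g + Q g) f = Pr P f + Pr Q f"
    and Pr_scale: "P \<in> dual2 cs \<Longrightarrow> f \<in> dual1 cs \<Longrightarrow> Pr (\<lambda>g. c * P g) f = c * Pr P f"
    and Pr_id: "P \<in> Aperpperp cs \<Longrightarrow> f \<in> dual1 cs \<Longrightarrow> Pr P f = P f"
    and bnorm_Pr: "P \<in> dual2 cs \<Longrightarrow> bnorm cs P = max (bnorm cs (Pr P)) (bnorm cs (\<lambda>f. P f - Pr P f))"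
begin

section \<open>Consequences of the maximum formula\<close>

abbreviation one2 :: "('a \<times> complex \<Rightarrow> complex) \<Rightarrow> complex" where
  "one2 \<equiv> canon (0, 1)"

lemma Pr_dual2: "P \<in> dual2 cs \<Longrightarrow> Pr P \<in> dual2 cs"
  using Pr_Aperpperp Aperpperp_dual2 by blast

lemma dual2_diff: "P \<in> dual2 cs \<Longrightarrow> Q \<in> dual2 cs \<Longrightarrow> P - Q \<in> dual2 cs"
  by (rule subspace_diff[OF B.subspace])

lemma Pr_diff:
  assumes P: "P \<in> dual2 cs" and Q: "Q \<in> dual2 cs" and f: "f \<in> dual1 cs"
  shows "Pr (P - Q) f = Pr P f - Pr Q f"
proof -
  have "P - Q = (\<lambda>g. P g + (- 1) * Q g)" by (simp add: fun_eq_iff)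
  then show ?thesis
    using Pr_add[OF P B.sc_closed[OF Q, of "-1"] f] Pr_scale[OF Q f, of "-1"] by simp
qed

lemma bnorm_Pr_le: "P \<in> dual2 cs \<Longrightarrow> bnorm cs (Pr P) \<le> bnorm cs P"
  using bnorm_Pr by force

text \<open>\<open>P - Pr Q\<close> has the component \<open>Pr (P - Q)\<close> in the bidual of
  \<open>A\<close> and the component \<open>P - Pr P\<close> in the complement. The maximum formula
  bounds each by \<open>r\<close> and then recombines them.\<close>

lemma bnorm_diff_Pr_le:
  assumes P: "P \<in> dual2 cs" and Q: "Q \<in> dual2 cs" and r: "bnorm cs P \<le> r" "bnorm cs (P - Q) \<le> r"
  shows "bnorm cs (P - Pr Q) \<le> r"
proof -
  let ?Y = "P - Pr Q"
  have Y: "?Y \<in> dual2 cs" using P Q by (intro dual2_diff Pr_dual2)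
  have PrY: "Pr ?Y f = Pr (P - Q) f" if "f \<in> dual1 cs" for f
    using that P Q by (simp add: Pr_diff Pr_dual2 Pr_id Pr_Aperpperp)
  have "bnorm cs (Pr ?Y) = bnorm cs (Pr (P - Q))" using PrY by (rule bnorm_cong)
  also have "\<dots> \<le> r" using bnorm_Pr_le[OF dual2_diff[OF P Q]] r by linarith
  finally have 1: "bnorm cs (Pr ?Y) \<le> r" .
  have "bnorm cs (\<lambda>f. ?Y f - Pr ?Y f) = bnorm cs (\<lambda>f. P f - Pr P f)"
    by (rule bnorm_cong) (use PrY P Q in \<open>simp add: Pr_diff\<close>)
  also have "\<dots> \<le> r" using bnorm_Pr[OF P] r by linarith
  finally show ?thesis using 1 bnorm_Pr[OF Y] by simp
qed

lemma bnorm_one_le: "bnorm cs one2 \<le> 1"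
  using bnorm_canon_le unorm_one_le order_trans by blast

lemma cai:
  obtains F :: "'a filter" where "F \<noteq> bot" "eventually (\<lambda>e. norm e \<le> 1) F"
    "\<And>a. ((\<lambda>e. e * a) \<longlongrightarrow> a) F" "\<And>a. ((\<lambda>e. a * e) \<longlongrightarrow> a) F"
  using approx_unital unfolding cai_in_def by auto

text \<open>Left multiplication by \<open>a\<close> nearly attains the norm of \<open>a\<close> on
  the contractive approximate identity, since \<open>a * e\<close> tends to
  \<open>a\<close>.\<close>

lemma unorm_embed: "unorm cs (a, 0) = norm a"
proof (rule antisym[OF unorm_embed_le])
  obtain F :: "'a filter" where F: "F \<noteq> bot" "eventually (\<lambda>e. norm e \<le> 1) F"
    "\<And>a. ((\<lambda>e. a * e) \<longlongrightarrow> a) F" using cai by metis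
  have "((\<lambda>e. norm (a * e)) \<longlongrightarrow> norm a) F" using F(3) by (rule tendsto_norm)
  moreover have "eventually (\<lambda>e. norm (a * e) \<le> unorm cs (a, 0)) F"
    using F(2) by eventually_elim (use unorm_upper[of _ "(a, 0)"] in \<open>simp add: act_def\<close>)
  ultimately show "norm a \<le> unorm cs (a, 0)" using F(1) tendsto_upperbound by blast
qed

text \<open>Replaces the excess \<open>d\<close> over radius 1 by an arbitrarily small excess
  \<open>e\<close>, at the cost of a move of length at most \<open>2 * d\<close>. This is the step
  to be iterated.\<close>

lemma two_ball:
  assumes a: "unorm cs (- a, 1) \<le> 1 + d" and d: "d > 0" and e: "0 < e" "e \<le> 1"
  obtains b where "unorm cs (- b, 1) \<le> 1 + e" "norm (b - a) \<le> 2 * d"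
proof -
  \<comment> \<open>The point of the segment from 1 to \<open>a\<close> that is within 1 of 1 and
    within \<open>d\<close> of \<open>a\<close>.\<close>
  define z where "z = (1 / (1 + d)) *\<^sub>R (a, 0) + (d / (1 + d)) *\<^sub>R (0, 1 :: complex)"
  have z2: "canon z \<in> dual2 cs" by (rule canon_dual2)
  have canon_diff: "bnorm cs (canon x - canon y) = bnorm cs (canon (x - y))" for x y
    by (rule bnorm_cong) (simp add: canon_def X.cdual_diff)
  have frac: "1 - d / (1 + d) = 1 / (1 + d)" "1 - 1 / (1 + d) = d / (1 + d)" using d by (auto simp: field_simps)
  have "(0, 1) - z = (1 / (1 + d)) *\<^sub>R (- a, 1)"
    unfolding z_def by (simp add: prod_eq_iff complex_eq_iff frac)
  then have "unorm cs ((0, 1) - z) = (1 / (1 + d)) * unorm cs (- a, 1)"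
    using d by (simp only: X.seminorm_scaleR UNIV_I) simp
  also have "\<dots> \<le> 1" using a d by (simp add: field_simps)
  finally have "bnorm cs (one2 - canon z) \<le> 1"
    unfolding canon_diff using bnorm_canon_le order_trans by blast
  then have 1: "bnorm cs (one2 - Pr (canon z)) \<le> 1"
    by (intro bnorm_diff_Pr_le canon_dual2 bnorm_one_le)
  have "a - (1 / (1 + d)) *\<^sub>R a = (d / (1 + d)) *\<^sub>R a"
    using scaleR_diff_left[of 1 "1 / (1 + d)" a] frac(2) by simp
  then have "(a, 0) - z = (- d / (1 + d)) *\<^sub>R (- a, 1)"
    unfolding z_def by (simp add: prod_eq_iff)
  then have "unorm cs ((a, 0) - z) = (d / (1 + d)) * unorm cs (- a, 1)"
    using d by (simp only: X.seminorm_scaleR UNIV_I) simp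
  also have "\<dots> \<le> (d / (1 + d)) * (1 + d)" using a d by (intro mult_left_mono) auto
  also have "\<dots> = d" using d by simp
  finally have "bnorm cs (canon (a, 0) - canon z) \<le> d"
    unfolding canon_diff using bnorm_canon_le order_trans by blast
  then have "bnorm cs (Pr (canon (a, 0) - canon z)) \<le> d"
    using bnorm_Pr_le[OF dual2_diff[OF canon_dual2 z2]] order_trans by blast
  also have "bnorm cs (Pr (canon (a, 0) - canon z)) = bnorm cs (canon (a, 0) - Pr (canon z))"
    by (rule bnorm_cong) (simp add: Pr_diff canon_dual2 Pr_id canon_Aperpperp)
  \<comment> \<open>Helly with radii 1 and \<open>d\<close> and no weak* constraint; in the second
    ball the factor \<open>1 + e\<close> is at most 2.\<close>
  finally obtain b where b: "unorm cs ((0, 1) - (b, 0)) \<le> 1 * (1 + e)" "unorm cs ((a, 0) - (b, 0)) \<le> d * (1 + e)"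
    using helly[OF Pr_Aperpperp[OF z2] _ d e(1) 1, of "(a, 0)" "{}"] by auto
  have "unorm cs ((a, 0) - (b, 0)) = norm (b - a)"
    using unorm_embed[of "a - b"] by (simp add: norm_minus_commute)
  moreover have "d * (1 + e) \<le> 2 * d" using d e by (simp add: algebra_simps)
  ultimately show thesis using that[of b] b by simp
qed

text \<open>The excess is halved at each step: moves of length at most \<open>2 * d / 2^n\<close>
  sum to \<open>4 * d\<close>, so the sequence converges by completeness and the limit has no excess
  left.\<close>

lemma nearby_FA:
  assumes a: "unorm cs (- a, 1) \<le> 1 + d" and d: "d > 0"
  obtains b where "b \<in> FA cs" "norm (b - a) \<le> 4 * d"
proof -
  define \<delta> where "\<delta> = (\<lambda>n::nat. d * (1/2) ^ n)"
  have \<delta>: "\<delta> n > 0" for n using d by (simp add: \<delta>_def)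
  have "\<exists>A. \<forall>n. (unorm cs (- A n, 1) \<le> 1 + \<delta> n \<and> (n = 0 \<longrightarrow> A n = a)) \<and> norm (A (Suc n) - A n) \<le> 2 * \<delta> n"
  proof (rule dependent_nat_choice)
    show "\<exists>x. unorm cs (- x, 1) \<le> 1 + \<delta> 0 \<and> (0 = 0 \<longrightarrow> x = a)" using a by (auto simp: \<delta>_def)
  next
    fix x n assume x: "unorm cs (- x, 1) \<le> 1 + \<delta> n \<and> (n = 0 \<longrightarrow> x = a)"
    \<comment> \<open>The minimum with 1 meets the requirement \<open>e \<le> 1\<close> of
      \<open>two_ball\<close>.\<close>
    obtain b where "unorm cs (- b, 1) \<le> 1 + min 1 (\<delta> (Suc n))" "norm (b - x) \<le> 2 * \<delta> n"
      using two_ball[of x "\<delta> n" "min 1 (\<delta> (Suc n))"] x \<delta> by auto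
    then show "\<exists>y. (unorm cs (- y, 1) \<le> 1 + \<delta> (Suc n) \<and> (Suc n = 0 \<longrightarrow> y = a)) \<and> norm (y - x) \<le> 2 * \<delta> n"
      by (intro exI[of _ b]) auto
  qed
  then obtain A where A: "\<And>n. unorm cs (- A n, 1) \<le> 1 + \<delta> n" "A 0 = a"
    "\<And>n. norm (A (Suc n) - A n) \<le> 2 * \<delta> n" by blast
  have sums: "(\<lambda>n. 2 * \<delta> n) sums (4 * d)"
    using sums_mult[OF geometric_sums[of "1/2 :: real"], of "2 * d"] by (simp add: \<delta>_def mult.assoc)
  have "summable (\<lambda>n. norm (A (Suc n) - A n))"
    by (rule summable_comparison_test'[OF sums_summable[OF sums], of 0]) (simp add: A(3))
  then have summ: "summable (\<lambda>n. A (Suc n) - A n)"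
    and "norm (\<Sum>n. A (Suc n) - A n) \<le> (\<Sum>n. norm (A (Suc n) - A n))"
    and "(\<Sum>n. norm (A (Suc n) - A n)) \<le> (\<Sum>n. 2 * \<delta> n)"
    using A(3) sums_summable[OF sums] by (auto intro: summable_norm_cancel summable_norm suminf_le)
  then have norm_le: "norm (\<Sum>n. A (Suc n) - A n) \<le> 4 * d"
    using sums_unique[OF sums] by linarith
  define b where "b = a + (\<Sum>n. A (Suc n) - A n)"
  have "(\<lambda>n. \<Sum>k<n. A (Suc k) - A k) \<longlonglongrightarrow> (\<Sum>n. A (Suc n) - A n)"
    using summ by (rule summable_LIMSEQ)
  then have "(\<lambda>n. a + (A n - A 0)) \<longlonglongrightarrow> b"
    unfolding b_def by (intro tendsto_add tendsto_const) (simp only: sum_lessThan_telescope)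
  then have lim: "A \<longlonglongrightarrow> b" by (simp add: A(2))
  have "unorm cs (- b, 1) \<le> (1 + \<delta> n) + norm (A n - b)" for n
  proof -
    have "unorm cs ((- A n, 1) + (A n - b, 0)) \<le> unorm cs (- A n, 1) + unorm cs (A n - b, 0)"
      by (rule X.triangle) auto
    then show ?thesis using A(1)[of n] by (simp add: unorm_embed)
  qed
  moreover have "(\<lambda>n. (1 + \<delta> n) + norm (A n - b)) \<longlonglongrightarrow> (1 + d * 0) + 0"
    unfolding \<delta>_def using lim by (intro tendsto_intros LIMSEQ_power_zero tendsto_norm_zero LIM_zero) auto
  ultimately have "unorm cs (- b, 1) \<le> (1 + d * 0) + 0"
    by (intro LIMSEQ_le_const) auto
  then show thesis using that[of b] norm_le by (simp add: FA_def b_def)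
qed

text \<open>The factor \<open>t\<close> serves both density theorems: \<open>t = 1\<close> for the
  ball around 1, and a suitable \<open>t\<close> for real positive elements, where the excess is
  taken proportional to \<open>t\<close>.\<close>

lemma approximate_by_FA:
  assumes P: "P \<in> Aperpperp cs" and le: "bnorm cs (one2 - (\<lambda>f. of_real t * P f)) < 1 + d"
    and d: "d > 0" and F: "finite F" "F \<subseteq> dual1 cs"
  obtains b where "b \<in> FA cs"
    "\<And>f. f \<in> F \<Longrightarrow> cmod (f (b, 0) - of_real t * P f) \<le> d * (1 + 4 * dnorm1 cs f)"
proof -
  let ?Q = "\<lambda>f. of_real t * P f"
  have Q: "?Q \<in> Aperpperp cs"
    using P B.sc_closed[of P] by (auto simp: Aperpperp_def)
  \<comment> \<open>The maximum with 1 keeps the radius for Helly positive.\<close>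
  define r where "r = max 1 (bnorm cs (one2 - ?Q))"
  have r: "r > 0" "r < 1 + d" "bnorm cs (one2 - ?Q) \<le> r" using le d by (auto simp: r_def)
  \<comment> \<open>Chosen so that \<open>r * (1 + e) \<le> 1 + d\<close>; it is positive because
    the norm bound is strict.\<close>
  define e where "e = min d ((1 + d - r) / r)"
  have e: "e > 0" "e \<le> d" "r * (1 + e) \<le> 1 + d"
  proof -
    have "e \<le> (1 + d - r) / r" by (simp add: e_def)
    then have "r * e \<le> 1 + d - r" using r by (simp add: field_simps)
    then show "r * (1 + e) \<le> 1 + d" by (simp add: algebra_simps)
  qed (use r d in \<open>auto simp: e_def\<close>)
  obtain a where a: "unorm cs ((0, 1) - (a, 0)) \<le> r * (1 + e)"
    "\<And>f. f \<in> F \<Longrightarrow> cmod (f (a, 0) - ?Q f) < e"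
    using helly[OF Q r(1) r(1) e(1) r(3) r(3) F] by blast
  have "unorm cs (- a, 1) \<le> 1 + d" using a(1) e(3) by simp
  then obtain b where b: "b \<in> FA cs" "norm (b - a) \<le> 4 * d" using nearby_FA d by blast
  have "cmod (f (b, 0) - ?Q f) \<le> d * (1 + 4 * dnorm1 cs f)" if f: "f \<in> F" for f
  proof -
    have fd: "f \<in> dual1 cs" using f F by auto
    have "f (b, 0) - f (a, 0) = f (b - a, 0)" using X.cdual_diff[OF fd, of "(b, 0)" "(a, 0)"] by simp
    then have "cmod (f (b, 0) - f (a, 0)) \<le> dnorm1 cs f * norm (b - a)"
      using X.cnorm_bound[OF fd, of "(b - a, 0)"] by (simp add: unorm_embed)
    also have "\<dots> \<le> dnorm1 cs f * (4 * d)" using b X.cnorm_nonneg[OF fd] by (intro mult_left_mono)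
    finally have "cmod (f (b, 0) - f (a, 0)) \<le> dnorm1 cs f * (4 * d)" .
    moreover have "cmod (f (a, 0) - ?Q f) < d" using a(2)[OF f] e by linarith
    ultimately show ?thesis
      using norm_triangle_ineq[of "f (b, 0) - f (a, 0)" "f (a, 0) - ?Q f"] by (simp add: algebra_simps)
  qed
  then show thesis using that b(1) by blast
qed

text \<open>Absorbs the factors \<open>1 + 4 * dnorm1 cs f\<close>, which are bounded over the
  finite set \<open>F\<close>.\<close>

lemma weak_star_denseI:
  assumes "\<And>a. a \<in> S \<Longrightarrow> canon (a, 0) \<in> T"
    and "\<And>P F d. P \<in> T \<Longrightarrow> finite F \<Longrightarrow> F \<subseteq> dual1 cs \<Longrightarrow> d > 0 \<Longrightarrow>
      \<exists>a\<in>S. \<forall>f\<in>F. cmod (f (a, 0) - P f) \<le> d * (1 + 4 * dnorm1 cs f)"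
  shows "weak_star_dense cs ((\<lambda>a. canon (a, 0)) ` S) T"
  unfolding weak_star_dense_def
proof (intro conjI ballI allI impI)
  fix P F and \<epsilon> :: real assume P: "P \<in> T" and F: "finite F \<and> F \<subseteq> dual1 cs" and \<epsilon>: "\<epsilon> > 0"
  define K where "K = (\<Sum>f\<in>F. 1 + 4 * dnorm1 cs f)"
  have pos: "0 \<le> dnorm1 cs f" if "f \<in> F" for f using that F X.cnorm_nonneg by auto
  have K: "1 + 4 * dnorm1 cs f \<le> K" if "f \<in> F" for f
    unfolding K_def using F that pos by (intro member_le_sum) auto
  have K0: "K \<ge> 0" unfolding K_def using pos by (intro sum_nonneg) auto
  \<comment> \<open>Dividing by \<open>K + 1\<close> covers \<open>K = 0\<close> and yields a strict
    inequality.\<close>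
  have \<eta>: "\<epsilon> / (K + 1) > 0" using K0 \<epsilon> by simp
  obtain a where a: "a \<in> S" "\<And>f. f \<in> F \<Longrightarrow> cmod (f (a, 0) - P f) \<le> \<epsilon> / (K + 1) * (1 + 4 * dnorm1 cs f)"
    using assms(2)[OF P conjunct1[OF F] conjunct2[OF F] \<eta>] by blast
  have "cmod (canon (a, 0) f - P f) < \<epsilon>" if f: "f \<in> F" for f
  proof -
    have "cmod (f (a, 0) - P f) \<le> \<epsilon> / (K + 1) * (1 + 4 * dnorm1 cs f)" by (rule a(2)[OF f])
    also have "\<dots> \<le> \<epsilon> / (K + 1) * K" using K[OF f] \<epsilon> K0 by (intro mult_left_mono) auto
    also have "\<dots> < \<epsilon>" using \<epsilon> K0 by (simp add: field_simps)
    finally show ?thesis by (simp add: canon_def)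
  qed
  then show "\<exists>Q\<in>(\<lambda>a. canon (a, 0)) ` S. \<forall>f\<in>F. cmod (Q f - P f) < \<epsilon>" using a(1) by blast
qed (use assms(1) in auto)

section \<open>The two weak* density theorems\<close>

lemma FAbb_eq: "FAbb cs = {P \<in> Aperpperp cs. bnorm cs (one2 - P) \<le> 1}"
  by (simp add: FAbb_def canon_def fun_diff_def)

theorem FA_weak_star_dense: "weak_star_dense cs ((\<lambda>a. canon (a, 0)) ` FA cs) (FAbb cs)"
proof (rule weak_star_denseI)
  fix a assume a: "a \<in> FA cs"
  have "bnorm cs (one2 - canon (a, 0)) = bnorm cs (canon (- a, 1))"
  proof (rule bnorm_cong)
    fix f assume "f \<in> dual1 cs"
    then show "(one2 - canon (a, 0)) f = canon (- a, 1) f"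
      using X.cdual_diff[of f "(0, 1)" "(a, 0)"] by (simp add: canon_def)
  qed
  also have "\<dots> \<le> 1" using a bnorm_canon_le[of "(- a, 1)"] by (simp add: FA_def)
  finally show "canon (a, 0) \<in> FAbb cs" by (simp add: FAbb_eq canon_Aperpperp)
next
  fix P F and d :: real
  assume P: "P \<in> FAbb cs" and F: "finite F" "F \<subseteq> dual1 cs" and d: "d > 0"
  show "\<exists>a\<in>FA cs. \<forall>f\<in>F. cmod (f (a, 0) - P f) \<le> d * (1 + 4 * dnorm1 cs f)"
  proof -
    have "P \<in> Aperpperp cs" "bnorm cs (one2 - (\<lambda>f. of_real 1 * P f)) < 1 + d"
      using P d by (auto simp: FAbb_eq)
    then obtain b where "b \<in> FA cs"
      "\<And>f. f \<in> F \<Longrightarrow> cmod (f (b, 0) - of_real 1 * P f) \<le> d * (1 + 4 * dnorm1 cs f)"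
      using approximate_by_FA[OF _ _ d F] by blast
    then show ?thesis by auto
  qed
qed

text \<open>A state sends \<open>1 - b\<close> into the closed unit disc, so its value at
  \<open>b\<close> has nonnegative real part; positive multiples inherit this.\<close>

lemma FA_scaled_rA:
  assumes b: "b \<in> FA cs" and t: "t > 0"
  shows "(1 / t) *\<^sub>R b \<in> rA cs"
  unfolding rA_def
proof (intro CollectI ballI)
  fix \<psi> assume "\<psi> \<in> states1 cs"
  then have \<psi>: "\<psi> \<in> dual1 cs" "dnorm1 cs \<psi> = 1" "\<psi> (0, 1) = 1" by (auto simp: states1_def)
  have "cmod (\<psi> (- b, 1)) \<le> 1"
    using X.cnorm_bound[OF \<psi>(1), of "(- b, 1)"] \<psi>(2) b by (simp add: FA_def)
  moreover have "\<psi> (- b, 1) = 1 - \<psi> (b, 0)"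
    using X.cdual_diff[OF \<psi>(1), of "(0, 1)" "(b, 0)"] \<psi>(3) by simp
  ultimately have "0 \<le> Re (\<psi> (b, 0))" using complex_Re_le_cmod[of "1 - \<psi> (b, 0)"] by simp
  moreover have "\<psi> ((1 / t) *\<^sub>R b, 0) = (1 / t) *\<^sub>R \<psi> (b, 0)"
    using X.cdual_scaleR[OF \<psi>(1), of "(b, 0)" "1 / t"] by simp
  ultimately show "0 \<le> Re (\<psi> ((1 / t) *\<^sub>R b, 0))" using t by simp
qed

text \<open>Otherwise the norm is at least 1 on the segment of all \<open>s - u P\<close> with \<open>s + u \<gamma> = 1\<close>,
  and separating that segment from the open unit ball yields a state with negative real part at \<open>P\<close>.\<close>
lemma rAbb_small_shift:
  assumes P: "P \<in> rAbb cs" and \<gamma>: "\<gamma> > 0"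
  shows "\<exists>t>0. bnorm cs (one2 - (\<lambda>f. of_real t * P f)) < 1 + t * \<gamma>"
proof (rule ccontr)
  assume no: "\<not> ?thesis"
  have P2: "P \<in> dual2 cs" using P by (auto simp: rAbb_def Aperpperp_def)
  have scaleR_eq: "(\<lambda>f. of_real t * P f) = t *\<^sub>R P" for t by (simp add: fun_eq_iff scaleR_conv_of_real)
  have ge: "1 + t * \<gamma> \<le> bnorm cs (one2 - t *\<^sub>R P)" if "t > 0" for t
    using no that by (force simp: scaleR_eq)
  have tri: "bnorm cs (one2 - t *\<^sub>R P) \<le> bnorm cs one2 + t * bnorm cs P" if "t \<ge> 0" for t
    using that B.triangle[OF canon_dual2, of "- (t *\<^sub>R P)"]
    by (simp add: P2 B.seminorm_uminus B.seminorm_scaleR subspace_neg[OF B.subspace] subspace_scale[OF B.subspace])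
  have Pn: "\<gamma> \<le> bnorm cs P"
  proof -
    have "1 + 1 * \<gamma> \<le> bnorm cs (one2 - 1 *\<^sub>R P)" by (rule ge) simp
    also have "\<dots> \<le> bnorm cs one2 + 1 * bnorm cs P" by (rule tri) simp
    also have "\<dots> \<le> 1 + bnorm cs P" using bnorm_one_le by simp
    finally show ?thesis by simp
  qed
  \<comment> \<open>\<open>one2 - u *\<^sub>R W\<close> is \<open>s\<close> times the identity minus
    \<open>u *\<^sub>R P\<close>, where \<open>s + u * \<gamma> = 1\<close>.\<close>
  define W where "W = \<gamma> *\<^sub>R one2 + P"
  define C where "C = (\<lambda>u. one2 - u *\<^sub>R W) ` {0..1 / \<gamma>}"
  have C2: "C \<subseteq> dual2 cs"
    unfolding C_def W_def using canon_dual2 P2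
    by (auto intro!: dual2_diff subspace_scale[OF B.subspace] subspace_add[OF B.subspace])
  have "1 \<le> bnorm cs Q" if Q: "Q \<in> C" for Q
  proof -
    obtain u where u: "0 \<le> u" "u \<le> 1 / \<gamma>" "Q = one2 - u *\<^sub>R W"
      using Q by (auto simp: C_def)
    consider "u = 0" | "u = 1 / \<gamma>" | "0 < u" "u < 1 / \<gamma>" using u by linarith
    then show ?thesis
    proof cases
      case 1
      \<comment> \<open>This endpoint is the limit of the assumed inequality as the shift tends to
        0; the shift chosen here costs exactly \<open>\<epsilon>\<close>.\<close>
      have "1 \<le> bnorm cs one2"
      proof (rule field_le_epsilon)
        fix \<epsilon> :: real assume \<epsilon>: "\<epsilon> > 0"
        let ?t = "\<epsilon> / bnorm cs P"
        have t: "?t > 0" using \<epsilon> Pn \<gamma> by simp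
        have "1 \<le> 1 + ?t * \<gamma>" using mult_pos_pos[OF t \<gamma>] by linarith
        also have "\<dots> \<le> bnorm cs (one2 - ?t *\<^sub>R P)" using t by (rule ge)
        also have "\<dots> \<le> bnorm cs one2 + ?t * bnorm cs P" using t by (intro tri) simp
        finally show "1 \<le> bnorm cs one2 + \<epsilon>" using Pn \<gamma> by simp
      qed
      then show ?thesis using u 1 by (simp add: W_def)
    next
      case 2
      \<comment> \<open>At the other endpoint only a multiple of \<open>P\<close> is left, and
        \<open>\<gamma> \<le> bnorm cs P\<close> applies.\<close>
      then have "Q = - ((1 / \<gamma>) *\<^sub>R P)" using u \<gamma> by (simp add: W_def scaleR_add_right)
      then have "bnorm cs Q = (1 / \<gamma>) * bnorm cs P"
        using \<gamma> by (simp add: B.seminorm_uminus B.seminorm_scaleR P2 subspace_scale[OF B.subspace P2])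
      then show ?thesis using Pn \<gamma> by (simp add: pos_le_divide_eq)
    next
      case 3
      define s where "s = 1 - u * \<gamma>"
      have s: "s > 0" using 3 \<gamma> by (simp add: s_def field_simps)
      have Qs: "Q = s *\<^sub>R (one2 - (u / s) *\<^sub>R P)" using u s by (simp add: W_def scaleR_diff_right scaleR_add_right) (simp add: s_def scaleR_diff_left)
      have "s + u * \<gamma> = s * (1 + (u / s) * \<gamma>)" using s by (simp add: field_simps)
      also have "\<dots> \<le> s * bnorm cs (one2 - (u / s) *\<^sub>R P)"
        using ge[of "u / s"] s 3 by (intro mult_left_mono) auto
      also have "\<dots> = bnorm cs Q"
        unfolding Qs using s by (subst B.seminorm_scaleR) (auto intro!: dual2_diff canon_dual2 P2 subspace_scale[OF B.subspace])
      finally show ?thesis by (simp add: s_def)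
    qed
  qed
  moreover have "C \<noteq> {}" using \<gamma> by (simp add: C_def)
  moreover have "convex C"
  proof (rule convexI)
    fix Q Q' and p q :: real
    assume "Q \<in> C" "Q' \<in> C" and pq: "p \<ge> 0" "q \<ge> 0" "p + q = 1"
    then obtain u v where uv: "u \<in> {0..1 / \<gamma>}" "v \<in> {0..1 / \<gamma>}" "Q = one2 - u *\<^sub>R W" "Q' = one2 - v *\<^sub>R W"
      by (auto simp: C_def)
    have "p *\<^sub>R Q + q *\<^sub>R Q' = (p + q) *\<^sub>R one2 - (p * u + q * v) *\<^sub>R W"
      by (simp add: uv algebra_simps)
    moreover have "p *\<^sub>R u + q *\<^sub>R v \<in> {0..1 / \<gamma>}"
      using convex_real_interval(5) uv(1,2) pq by (rule convexD)
    ultimately show "p *\<^sub>R Q + q *\<^sub>R Q' \<in> C" using pq by (auto simp: C_def)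
  qed
  ultimately obtain g where g: "linear_functional_on (dual2 cs) g" "\<And>Q. Q \<in> dual2 cs \<Longrightarrow> g Q \<le> bnorm cs Q"
    "\<And>Q. Q \<in> C \<Longrightarrow> 1 \<le> g Q"
    using convex_separation[OF B.subspace B.sublinear_on_seminorm C2, of 1] by blast
  obtain \<phi> where \<phi>: "\<phi> \<in> dual3 cs" "tnorm cs \<phi> \<le> 1" "\<And>Q. Q \<in> dual2 cs \<Longrightarrow> Re (\<phi> Q) = g Q"
    using B.complexify_functional[OF g(1), of 1] g(2) by auto
  \<comment> \<open>The value of \<open>\<phi>\<close> at the identity has real part at least 1 and
    modulus at most 1, hence equals 1: \<open>\<phi>\<close> is a state.\<close>
  have "one2 \<in> C" using \<gamma> by (auto simp: C_def intro!: image_eqI[of _ _ 0])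
  then have re: "1 \<le> Re (\<phi> one2)" using g(3) \<phi>(3) canon_dual2 by simp
  have "cmod (\<phi> one2) \<le> tnorm cs \<phi>" by (rule B.cnorm_upper[OF \<phi>(1) canon_dual2 bnorm_one_le])
  with re \<phi>(2) have "tnorm cs \<phi> = 1" "cmod (\<phi> one2) = 1" "Re (\<phi> one2) = 1"
    using complex_Re_le_cmod[of "\<phi> one2"] by linarith+
  moreover from this have "\<phi> one2 = 1"
    using cmod_power2[of "\<phi> one2"] by (simp add: complex_eq_iff)
  ultimately have "\<phi> \<in> states2 cs" using \<phi>(1) by (simp add: states2_def)
  then have "0 \<le> Re (\<phi> P)" using P by (simp add: rAbb_def)
  \<comment> \<open>This endpoint of the segment gives
    \<open>Re (\<phi> P) \<le> - \<gamma>\<close>.\<close>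
  moreover have "- ((1 / \<gamma>) *\<^sub>R P) \<in> C"
    using \<gamma> by (auto simp: C_def W_def scaleR_add_right intro!: image_eqI[of _ _ "1 / \<gamma>"])
  then have "1 \<le> Re (\<phi> (- ((1 / \<gamma>) *\<^sub>R P)))" using g(3) \<phi>(3) C2 by force
  then have "1 \<le> - ((1 / \<gamma>) * Re (\<phi> P))"
    by (simp add: B.cdual_uminus[OF \<phi>(1)] B.cdual_scaleR[OF \<phi>(1)] P2 subspace_scale[OF B.subspace P2])
  ultimately show False using \<gamma> by (simp add: field_simps)
qed

text \<open>States of the bidual restrict to states of \<open>A^1\<close>, which gives the
  inclusion. For density, \<open>t P\<close> is approximated from \<open>FA\<close> with an error of
  order \<open>t * d\<close>, and division by \<open>t\<close> leaves an error of order
  \<open>d\<close>.\<close>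

theorem rA_weak_star_dense: "weak_star_dense cs ((\<lambda>a. canon (a, 0)) ` rA cs) (rAbb cs)"
proof (rule weak_star_denseI)
  fix a assume a: "a \<in> rA cs"
  have "0 \<le> Re (\<phi> (canon (a, 0)))" if "\<phi> \<in> states2 cs" for \<phi>
  proof -
    have \<phi>: "\<phi> \<in> dual3 cs" "tnorm cs \<phi> = 1" "\<phi> one2 = 1" using that by (auto simp: states2_def)
    let ?\<psi> = "\<lambda>x. \<phi> (canon x)"
    \<comment> \<open>\<open>canon\<close> is linear only at points of \<open>dual1\<close>; a
      bounded functional does not see the values elsewhere.\<close>
    have cong: "\<phi> P = \<phi> Q" if "P \<in> dual2 cs" "Q \<in> dual2 cs" "\<And>f. f \<in> dual1 cs \<Longrightarrow> P f = Q f" for P Q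
    proof -
      have "bnorm cs (P - Q) = bnorm cs 0" by (rule bnorm_cong) (simp add: that)
      then have "cmod (\<phi> (P - Q)) \<le> 0"
        using B.cnorm_bound[OF \<phi>(1) dual2_diff[OF that(1,2)]] B.seminorm_zero by simp
      then show ?thesis using B.cdual_diff[OF \<phi>(1) that(1,2)] by simp
    qed
    have "?\<psi> (x + y) = ?\<psi> x + ?\<psi> y" for x y
    proof -
      have "\<phi> (canon (x + y)) = \<phi> (canon x + canon y)"
        by (intro cong canon_dual2 subspace_add[OF B.subspace]) (simp add: canon_def dual1_additive)
      then show ?thesis using B.cdual_add[OF \<phi>(1) canon_dual2 canon_dual2] by simp
    qed
    moreover have "?\<psi> (csX c x) = c * ?\<psi> x" for c x
    proof -
      have "\<phi> (canon (csX c x)) = \<phi> (\<lambda>f. c * canon x f)"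
        by (intro cong canon_dual2 B.sc_closed) (simp add: canon_def dual1_csX)
      then show ?thesis using B.cdual_sc[OF \<phi>(1) canon_dual2] by simp
    qed
    moreover have bd: "cmod (?\<psi> x) \<le> 1 * unorm cs x" for x
      using B.cnorm_bound[OF \<phi>(1) canon_dual2[of x]] bnorm_canon_le[of x] \<phi>(2) by simp
    ultimately have \<psi>: "?\<psi> \<in> dual1 cs" unfolding dual1_def csX_def plus_prod_def by blast
    have "dnorm1 cs ?\<psi> \<le> 1" by (rule X.cnorm_le) (use bd in auto)
    moreover have "1 \<le> dnorm1 cs ?\<psi>" using X.cnorm_upper[OF \<psi> UNIV_I unorm_one_le] \<phi>(3) by simp
    ultimately have "?\<psi> \<in> states1 cs" using \<psi> \<phi>(3) by (simp add: states1_def)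
    then show ?thesis using a by (auto simp: rA_def)
  qed
  then show "canon (a, 0) \<in> rAbb cs" by (simp add: rAbb_def canon_Aperpperp)
next
  fix P F and d :: real
  assume P: "P \<in> rAbb cs" and F: "finite F" "F \<subseteq> dual1 cs" and d: "d > 0"
  have P': "P \<in> Aperpperp cs" using P by (simp add: rAbb_def)
  obtain t where t: "t > 0" "bnorm cs (one2 - (\<lambda>f. of_real t * P f)) < 1 + t * d"
    using rAbb_small_shift[OF P d] by blast
  have "t * d > 0" using t d by simp
  then obtain b where b: "b \<in> FA cs"
    "\<And>f. f \<in> F \<Longrightarrow> cmod (f (b, 0) - of_real t * P f) \<le> t * d * (1 + 4 * dnorm1 cs f)"
    using approximate_by_FA[OF P' t(2) _ F] by blast
  have "cmod (f ((1 / t) *\<^sub>R b, 0) - P f) \<le> d * (1 + 4 * dnorm1 cs f)" if f: "f \<in> F" for f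
  proof -
    have "f ((1 / t) *\<^sub>R b, 0) = (1 / t) *\<^sub>R f (b, 0)"
      using X.cdual_scaleR[of f "(b, 0)" "1 / t"] f F by auto
    then have "f ((1 / t) *\<^sub>R b, 0) - P f = (1 / t) *\<^sub>R (f (b, 0) - of_real t * P f)"
      using t by (simp add: scaleR_conv_of_real field_simps)
    then have "cmod (f ((1 / t) *\<^sub>R b, 0) - P f) = (1 / t) * cmod (f (b, 0) - of_real t * P f)"
      using t by simp
    also have "\<dots> \<le> (1 / t) * (t * d * (1 + 4 * dnorm1 cs f))"
      using b(2)[OF f] t by (intro mult_left_mono) auto
    also have "\<dots> = d * (1 + 4 * dnorm1 cs f)" using t by simp
    finally show ?thesis .
  qed
  then show "\<exists>a\<in>rA cs. \<forall>f\<in>F. cmod (f (a, 0) - P f) \<le> d * (1 + 4 * dnorm1 cs f)"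
    using FA_scaled_rA[OF b(1) t(1)] by blast
qed

end

section \<open>The contractive approximate identity\<close>

context complex_algebra
begin

sublocale A: complex_seminormed UNIV cs norm
  by unfold_locales (auto simp: cs_add cs_add_left cs_cs cs_of_real norm_cs norm_triangle_ineq)

text \<open>The Boolean treats left and right multiplication together, since the approximate
  identity has to be two-sided.\<close>

definition side_mult :: "bool \<Rightarrow> 'a \<times> complex \<Rightarrow> 'a \<Rightarrow> 'a" where
  "side_mult left x b = (if left then fst x * b else b * fst x) + cs (snd x) b"

lemma side_mult_add: "side_mult l (x + y) b = side_mult l x b + side_mult l y b"
  by (simp add: side_mult_def cs_add_left distrib_left distrib_right)

lemma side_mult_csX: "side_mult l (csX c x) b = cs c (side_mult l x b)"
  by (simp add: side_mult_def csX_def cs_add cs_cs cs_mult_left cs_mult_right)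

lemma side_mult_add_right: "side_mult l x (b + d) = side_mult l x b + side_mult l x d"
  by (simp add: side_mult_def cs_add distrib_left distrib_right)

lemma side_mult_cs_right: "side_mult l x (cs c b) = cs c (side_mult l x b)"
  using cs_cs[of "snd x" c b] cs_cs[of c "snd x" b]
  by (simp add: side_mult_def cs_add cs_mult_left cs_mult_right mult.commute)

lemma side_mult_one: "side_mult l (0, 1) b = b"
  by (simp add: side_mult_def)

end

context M_ideal_algebra
begin

text \<open>\<open>unorm\<close> is defined through left multiplication. For the other side,
  \<open>(b x) e = b (x e)\<close> moves the estimate to the left action on \<open>e\<close>, and
  \<open>e\<close> runs through the approximate identity.\<close>

lemma norm_side_mult_le: "norm (side_mult l x b) \<le> unorm cs x * norm b"
proof (cases l)
  case True
  then show ?thesis using norm_act_unorm[of x b] by (simp add: side_mult_def act_def)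
next
  case False
  obtain F :: "'a filter" where F: "F \<noteq> bot" "eventually (\<lambda>e. norm e \<le> 1) F"
    "\<And>a. ((\<lambda>e. a * e) \<longlongrightarrow> a) F" using cai by metis
  have "((\<lambda>e. norm (side_mult l x b * e)) \<longlongrightarrow> norm (side_mult l x b)) F"
    using F(3) by (rule tendsto_norm)
  moreover have "eventually (\<lambda>e. norm (side_mult l x b * e) \<le> unorm cs x * norm b) F"
    using F(2)
  proof eventually_elim
    case (elim e)
    have "side_mult l x b * e = b * act x e"
      using False by (simp add: side_mult_def act_def distrib_left distrib_right mult.assoc cs_mult_left cs_mult_right)
    then have "norm (side_mult l x b * e) \<le> norm b * norm (act x e)" by (simp add: norm_mult_ineq)
    also have "\<dots> \<le> norm b * unorm cs x" using unorm_upper[OF elim] by (intro mult_left_mono) auto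
    finally show ?case by (simp add: mult.commute)
  qed
  ultimately show ?thesis using F(1) tendsto_upperbound by blast
qed

text \<open>The functionals \<open>f(\<cdot> b)\<close> and \<open>f(b \<cdot>)\<close>, extended to
  \<open>A^1\<close>.\<close>

abbreviation slice :: "bool \<Rightarrow> ('a \<Rightarrow> complex) \<Rightarrow> 'a \<Rightarrow> 'a \<times> complex \<Rightarrow> complex" where
  "slice l f b \<equiv> (\<lambda>x. f (side_mult l x b))"

lemma slice_bound:
  assumes "\<And>b. cmod (f b) \<le> K * norm b" "K \<ge> 0"
  shows "cmod (slice l f b x) \<le> (K * norm b) * unorm cs x"
proof -
  have "cmod (slice l f b x) \<le> K * norm (side_mult l x b)" by (rule assms(1))
  also have "\<dots> \<le> K * (unorm cs x * norm b)" using norm_side_mult_le assms(2) by (rule mult_left_mono)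
  finally show ?thesis by (simp add: algebra_simps)
qed

lemma slice_dual1:
  assumes f: "f \<in> A.cdual"
  shows "slice l f b \<in> dual1 cs"
proof -
  obtain K where "K \<ge> 0" "\<And>b. cmod (f b) \<le> K * norm b" using A.cdualE_nonneg[OF f] by auto
  then have "\<exists>K. \<forall>x. cmod (slice l f b x) \<le> K * unorm cs x" using slice_bound by blast
  moreover have "slice l f b (x + y) = slice l f b x + slice l f b y" "slice l f b (csX c x) = c * slice l f b x" for x y c
    using A.cdual_add[OF f] A.cdual_sc[OF f] by (simp_all add: side_mult_add side_mult_csX)
  ultimately show ?thesis unfolding dual1_def csX_def plus_prod_def by blast
qed

lemma dnorm1_slice_le:
  assumes "\<And>b. cmod (f b) \<le> K * norm b" "K \<ge> 0"
  shows "dnorm1 cs (slice l f b) \<le> K * norm b"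
  by (rule X.cnorm_le) (use slice_bound[OF assms] assms(2) in auto)

section \<open>The complementary part of the identity acts as zero on \<open>A\<close>\<close>

abbreviation "corner \<equiv> one2 - Pr one2"

lemma corner_dual2: "corner \<in> dual2 cs"
  by (intro dual2_diff Pr_dual2 canon_dual2)

text \<open>The operator \<open>T\<close> on the dual of \<open>A\<close>, for either side.\<close>

definition corner_op :: "bool \<Rightarrow> ('a \<Rightarrow> complex) \<Rightarrow> 'a \<Rightarrow> complex" where
  "corner_op l f b = corner (slice l f b)"

text \<open>Contractivity of \<open>1 + s T\<close>. For \<open>c\<close> in the unit ball,
  \<open>c + s (1 - Pr 1)\<close> has norm at most 1; letting \<open>c\<close> run through the
  approximate identity turns the slice value at \<open>c\<close> into \<open>f b\<close>.\<close>

lemma corner_op_bound: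
  assumes f: "f \<in> A.cdual" and K: "\<And>b. cmod (f b) \<le> K * norm b" "K \<ge> 0" and s: "cmod s \<le> 1"
  shows "cmod (f b + s * corner_op l f b) \<le> K * norm b"
proof -
  obtain F :: "'a filter" where F: "F \<noteq> bot" "eventually (\<lambda>e. norm e \<le> 1) F"
    "\<And>a. ((\<lambda>e. e * a) \<longlongrightarrow> a) F" "\<And>a. ((\<lambda>e. a * e) \<longlongrightarrow> a) F" using cai by blast
  let ?g = "slice l f b"
  have g: "?g \<in> dual1 cs" using f by (rule slice_dual1)
  have le: "cmod (f (side_mult l (c, 0) b) + s * corner_op l f b) \<le> K * norm b" if c: "norm c \<le> 1" for c
  proof -
    \<comment> \<open>With this choice \<open>?P - Pr (?P - ?C)\<close> is
      \<open>c + s (1 - Pr 1)\<close>, since the projection fixes \<open>c\<close>.\<close>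
    let ?P = "\<lambda>h. s * one2 h" and ?C = "canon (c, 0)"
    have P: "?P \<in> dual2 cs" by (intro B.sc_closed canon_dual2)
    have Q: "?P - ?C \<in> dual2 cs" using P canon_dual2 by (rule dual2_diff)
    have "bnorm cs ?P \<le> 1"
      using B.seminorm_sc[OF canon_dual2, of s "(0, 1)"] mult_mono[OF s bnorm_one_le] B.seminorm_nonneg[OF canon_dual2] by simp
    moreover have "bnorm cs (?P - (?P - ?C)) \<le> 1"
      using order_trans[OF bnorm_canon_le unorm_embed_le, of c] c by simp
    ultimately have "bnorm cs (?P - Pr (?P - ?C)) \<le> 1" using P Q by (intro bnorm_diff_Pr_le)
    moreover have "cmod ((?P - Pr (?P - ?C)) ?g) \<le> bnorm cs (?P - Pr (?P - ?C)) * dnorm1 cs ?g"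
      by (rule D.cnorm_bound[OF dual2_diff[OF P Pr_dual2[OF Q]] g])
    moreover have "\<dots> \<le> 1 * (K * norm b)"
      using calculation dnorm1_slice_le[OF K, of l b] X.cnorm_nonneg[OF g] by (intro mult_mono) auto
    moreover have "(?P - Pr (?P - ?C)) ?g = f (side_mult l (c, 0) b) + s * corner_op l f b"
      using g P by (simp add: Pr_diff Pr_scale canon_dual2 Pr_id canon_Aperpperp corner_op_def)
        (simp add: canon_def algebra_simps)
    ultimately show ?thesis by simp
  qed
  have "((\<lambda>c. side_mult l (c, 0) b) \<longlongrightarrow> b) F" using F(3,4) by (cases l) (simp_all add: side_mult_def)
  then have "((\<lambda>c. side_mult l (c, 0) b - b) \<longlongrightarrow> 0) F" by (rule LIM_zero)
  then have "((\<lambda>c. f (side_mult l (c, 0) b) - f b) \<longlongrightarrow> 0) F"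
    by (rule tendsto_0_le[where K = K]) (use K(1) in \<open>simp add: mult.commute flip: A.cdual_diff[OF f]\<close>)
  then have "((\<lambda>c. f (side_mult l (c, 0) b)) \<longlongrightarrow> f b) F" by (rule LIM_zero_cancel)
  then have "((\<lambda>c. cmod (f (side_mult l (c, 0) b) + s * corner_op l f b)) \<longlongrightarrow> cmod (f b + s * corner_op l f b)) F"
    by (intro tendsto_intros)
  moreover have "eventually (\<lambda>c. cmod (f (side_mult l (c, 0) b) + s * corner_op l f b) \<le> K * norm b) F"
    using F(2) by eventually_elim (rule le)
  ultimately show ?thesis using F(1) tendsto_upperbound by blast
qed

text \<open>Allows \<open>T\<close> to be iterated, as squares of \<open>1 + s w T\<close> occur
  below.\<close>

lemma corner_op_cdual:
  assumes f: "f \<in> A.cdual"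
  shows "corner_op l f \<in> A.cdual"
proof -
  obtain K where K: "K \<ge> 0" "\<And>b. cmod (f b) \<le> K * norm b" using A.cdualE_nonneg[OF f] by auto
  have "cmod (corner_op l f b) \<le> (bnorm cs corner * K) * norm b" for b
    using D.cnorm_bound[OF corner_dual2 slice_dual1[OF f, of l b]]
      mult_left_mono[OF dnorm1_slice_le[OF K(2,1), of l b] D.cnorm_nonneg[OF corner_dual2]]
    unfolding corner_op_def by linarith
  moreover have "corner_op l f (b + d) = corner_op l f b + corner_op l f d" for b d
  proof -
    have "slice l f (b + d) = slice l f b + slice l f d"
      by (simp add: fun_eq_iff side_mult_add_right A.cdual_add[OF f])
    then show ?thesis unfolding corner_op_def by (simp only: D.cdual_add[OF corner_dual2 slice_dual1[OF f] slice_dual1[OF f]])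
  qed
  moreover have "corner_op l f (cs c b) = c * corner_op l f b" for b c
  proof -
    have "slice l f (cs c b) = (\<lambda>x. c * slice l f b x)"
      by (simp add: fun_eq_iff side_mult_cs_right A.cdual_sc[OF f])
    then show ?thesis unfolding corner_op_def by (simp only: D.cdual_sc[OF corner_dual2 slice_dual1[OF f]])
  qed
  ultimately show ?thesis unfolding A.cdual_def by blast
qed

lemma cdual_add_mult: "f \<in> A.cdual \<Longrightarrow> g \<in> A.cdual \<Longrightarrow> (\<lambda>b. f b + c * g b) \<in> A.cdual"
proof -
  interpret Ad: complex_seminormed A.cdual "\<lambda>c f x. c * f x" A.cnorm by (rule A.complex_seminormed_dual)
  assume "f \<in> A.cdual" "g \<in> A.cdual"
  then have "f + (\<lambda>b. c * g b) \<in> A.cdual" by (intro subspace_add[OF Ad.subspace] Ad.sc_closed)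
  then show ?thesis by (simp add: plus_fun_def)
qed

lemma corner_op_linear:
  assumes f: "f \<in> A.cdual" and g: "g \<in> A.cdual"
  shows "corner_op l (\<lambda>b. f b + c * g b) b = corner_op l f b + c * corner_op l g b"
proof -
  have "slice l (\<lambda>b. f b + c * g b) b = slice l f b + (\<lambda>x. c * slice l g b x)"
    by (simp add: fun_eq_iff)
  then show ?thesis unfolding corner_op_def
    by (simp only: D.cdual_add[OF corner_dual2 slice_dual1[OF f] D.sc_closed[OF slice_dual1[OF g]]]
        D.cdual_sc[OF corner_dual2 slice_dual1[OF g]])
qed

text \<open>Averaging the squares of \<open>1 + s w T\<close> over \<open>w = (1 \<plusminus> \<i>) / 2\<close> gives \<open>1 + s T\<close> since \<open>w\<^sup>2 = \<plusminus> \<i> / 2\<close>: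
  if \<open>1 + s T\<close> is contractive for all \<open>s\<close> in a disc, it is so in a disc larger by a factor \<open>\<surd>2\<close>.\<close>
lemma corner_op_bound_power:
  assumes "cmod s ^ 2 \<le> 2 ^ k" "f \<in> A.cdual" "\<And>b. cmod (f b) \<le> K * norm b" "K \<ge> 0"
  shows "cmod (f b + s * corner_op l f b) \<le> K * norm b"
  using assms
proof (induction k arbitrary: s f b)
  case 0
  then have "cmod s \<le> 1" by (simp add: power2_le_imp_le[of _ 1, simplified] abs_square_le_1)
  then show ?case using corner_op_bound 0 by blast
next
  case (Suc k)
  let ?T = "corner_op l"
  have Tf: "?T f \<in> A.cdual" "?T (?T f) \<in> A.cdual" using Suc.prems corner_op_cdual by auto
  have sq: "cmod (f b + 2 * s * w * ?T f b + (s * w)\<^sup>2 * ?T (?T f) b) \<le> K * norm b"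
    if w: "cmod w ^ 2 = 1 / 2" for w
  proof -
    have sw: "cmod (s * w) ^ 2 \<le> 2 ^ k" using Suc.prems(1) by (simp only: norm_mult power_mult_distrib w) simp
    \<comment> \<open>The induction hypothesis is used twice, for \<open>f\<close> and then for
      \<open>?h\<close>, as \<open>s * w\<close> lies in the smaller disc.\<close>
    let ?h = "\<lambda>b. f b + (s * w) * ?T f b"
    have h: "?h \<in> A.cdual" using Suc.prems(2) Tf(1) by (rule cdual_add_mult)
    have "cmod (?h b) \<le> K * norm b" for b using Suc.IH[OF sw Suc.prems(2-4)] .
    then have "cmod (?h b + (s * w) * ?T ?h b) \<le> K * norm b" using Suc.IH[OF sw h] Suc.prems(4) by blast
    moreover have "?T ?h b = ?T f b + (s * w) * ?T (?T f) b" by (rule corner_op_linear[OF Suc.prems(2) Tf(1)])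
    ultimately show ?thesis by (simp add: algebra_simps power2_eq_square)
  qed
  define v w where "v = Complex (1/2) (1/2)" and "w = Complex (1/2) (- (1/2))"
  have vw: "cmod v ^ 2 = 1 / 2" "cmod w ^ 2 = 1 / 2" "v + w = 1" "v\<^sup>2 + w\<^sup>2 = 0"
    unfolding cmod_power2 by (simp_all add: v_def w_def complex_eq_iff power2_eq_square)
  have "2 * (f b + s * ?T f b) = 2 * f b + 2 * s * (v + w) * ?T f b + s\<^sup>2 * (v\<^sup>2 + w\<^sup>2) * ?T (?T f) b"
    by (simp only: vw) simp
  also have "\<dots> = (f b + 2 * s * v * ?T f b + (s * v)\<^sup>2 * ?T (?T f) b)
      + (f b + 2 * s * w * ?T f b + (s * w)\<^sup>2 * ?T (?T f) b)"
    by (simp add: algebra_simps power_mult_distrib)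
  finally have "cmod (2 * (f b + s * ?T f b)) \<le> K * norm b + K * norm b"
    using norm_triangle_mono[OF sq[OF vw(1)] sq[OF vw(2)]] by simp
  then show ?case by (simp only: norm_mult norm_numeral)
qed

text \<open>\<open>1 + s T\<close> is contractive for arbitrarily large \<open>s\<close>, which
  leaves no room for a nonzero value of \<open>T f\<close>.\<close>

lemma corner_op_zero:
  assumes f: "f \<in> A.cdual"
  shows "corner_op l f b = 0"
proof (rule ccontr)
  assume ne: "corner_op l f b \<noteq> 0"
  obtain K where K: "K \<ge> 0" "\<And>b. cmod (f b) \<le> K * norm b" using A.cdualE_nonneg[OF f] by auto
  have le: "2 ^ k * cmod (corner_op l f b) \<le> 2 * (K * norm b)" for k :: nat
  proof -
    have "cmod (2 ^ k) ^ 2 \<le> (2 :: real) ^ (2 * k)" by (simp add: norm_power power_mult[symmetric] mult.commute)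
    then have "cmod (f b + 2 ^ k * corner_op l f b) \<le> K * norm b"
      using corner_op_bound_power f K by blast
    moreover have "cmod (2 ^ k * corner_op l f b) \<le> cmod (f b + 2 ^ k * corner_op l f b) + cmod (f b)"
      using norm_triangle_ineq4[of "f b + 2 ^ k * corner_op l f b" "f b"] by simp
    ultimately show ?thesis using K(2)[of b] by (simp add: norm_mult norm_power)
  qed
  obtain k :: nat where "2 * (K * norm b) / cmod (corner_op l f b) < 2 ^ k"
    using real_arch_pow[of 2] by auto
  then show False using le[of k] ne by (simp add: field_simps)
qed

text \<open>As the complementary part vanishes, the value is that of the slice at 1. Thus
  \<open>Pr 1\<close> behaves as a two-sided identity for \<open>A\<close>.\<close>

lemma Pr_one_slice:
  assumes f: "f \<in> A.cdual"
  shows "Pr one2 (slice l f b) = f b"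
  using corner_op_zero[OF f, of l b] by (simp add: corner_op_def) (simp add: canon_def side_mult_one)

text \<open>\<open>bnorm_diff_Pr_le\<close> for the identity and its double, whose difference is
  minus the identity.\<close>

lemma twice_Pr_one_FAbb: "(\<lambda>f. 2 * Pr one2 f) \<in> FAbb cs"
proof -
  let ?Q = "\<lambda>f. 2 * one2 f"
  have Q: "?Q \<in> dual2 cs" by (intro B.sc_closed canon_dual2)
  have eq: "one2 - ?Q = - one2" by (simp add: fun_eq_iff)
  have "bnorm cs (one2 - ?Q) \<le> 1"
    unfolding eq using bnorm_one_le by (simp only: B.seminorm_uminus canon_dual2)
  then have "bnorm cs (one2 - Pr ?Q) \<le> 1"
    by (intro bnorm_diff_Pr_le canon_dual2 Q bnorm_one_le)
  also have "bnorm cs (one2 - Pr ?Q) = bnorm cs (one2 - (\<lambda>f. 2 * Pr one2 f))"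
    by (rule bnorm_cong) (simp add: Pr_scale canon_dual2)
  finally show ?thesis
    using Pr_Aperpperp[OF canon_dual2, of "(0, 1)"] B.sc_closed by (auto simp: FAbb_eq Aperpperp_def)
qed

text \<open>\<open>2 h = 1 - (1 - 2 h)\<close> is a difference of two elements of norm at most
  1.\<close>

lemma halfFA_norm_le:
  assumes "h \<in> halfFA cs"
  shows "norm h \<le> 1"
proof -
  have "unorm cs ((0, 1) + - (- (2 *\<^sub>R h), 1)) \<le> unorm cs (0, 1) + unorm cs (- (- (2 *\<^sub>R h), 1))"
    by (rule X.triangle) auto
  also have "unorm cs (- (- (2 *\<^sub>R h), 1)) \<le> 1"
    using assms X.seminorm_uminus[of "(- (2 *\<^sub>R h), 1)"] by (simp add: halfFA_def cs_two)
  finally show ?thesis using unorm_one_le unorm_embed[of "2 *\<^sub>R h"] by simp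
qed

section \<open>From weak to norm approximation by convexity\<close>

lemma convex_halfFA: "convex (halfFA cs)"
proof (rule convexI)
  fix h k and p q :: real
  assume h: "h \<in> halfFA cs" "k \<in> halfFA cs" and pq: "p \<ge> 0" "q \<ge> 0" "p + q = 1"
  have "p *\<^sub>R (- cs 2 h, 1) + q *\<^sub>R (- cs 2 k, 1) = (- cs 2 (p *\<^sub>R h + q *\<^sub>R k), 1 :: complex)"
    using pq by (simp add: cs_add cs_scaleR flip: scaleR_add_left)
  moreover have "unorm cs (p *\<^sub>R (- cs 2 h, 1) + q *\<^sub>R (- cs 2 k, 1)) \<le> p * unorm cs (- cs 2 h, 1) + q * unorm cs (- cs 2 k, 1)"
    using X.triangle[of "p *\<^sub>R (- cs 2 h, 1)" "q *\<^sub>R (- cs 2 k, 1)"] pq by (simp only: X.seminorm_scaleR UNIV_I abs_of_nonneg)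
  moreover have "p * unorm cs (- cs 2 h, 1) + q * unorm cs (- cs 2 k, 1) \<le> p * 1 + q * 1"
    using h pq by (intro add_mono mult_left_mono) (auto simp: halfFA_def)
  ultimately show "p *\<^sub>R h + q *\<^sub>R k \<in> halfFA cs" using pq by (simp add: halfFA_def)
qed

text \<open>Mazur's argument: if the error tuples formed by \<open>h b - b\<close> and
  \<open>b h - b\<close> stay away from 0, a functional separates their convex set from 0. On these
  tuples it is given by finitely many slices, and elements of \<open>halfFA\<close> weak* close to
  \<open>Pr 1\<close> make it small.\<close>

lemma halfFA_approximate_unit:
  assumes B: "finite B" and e: "e > 0"
  shows "\<exists>h\<in>halfFA cs. \<forall>b\<in>B. norm (h * b - b) < e \<and> norm (b * h - b) < e"
proof (rule ccontr)
  assume no: "\<not> ?thesis"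
  define I where "I = B \<times> (UNIV :: bool set)"
  have I: "finite I" using B by (simp add: I_def)
  define N :: "('a \<times> bool \<Rightarrow> 'a) \<Rightarrow> real" where "N = (\<lambda>u. \<Sum>i\<in>I. norm (u i))"
  define \<kappa> where "\<kappa> = (\<lambda>h i. side_mult (snd i) (h, 0) (fst i) - fst i)"
  have Nsub: "sublinear_on UNIV N"
    by (rule sublinear_onI)
      (auto simp: N_def sum_distrib_left sum.distrib[symmetric] intro!: sum_mono norm_triangle_ineq)
  have "e \<le> N (\<kappa> h)" if h: "h \<in> halfFA cs" for h
  proof (rule ccontr)
    assume "\<not> e \<le> N (\<kappa> h)"
    then have "norm (\<kappa> h i) < e" if "i \<in> I" for i
      using member_le_sum[OF that, of "\<lambda>i. norm (\<kappa> h i)"] I by (simp add: N_def)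
    from this[of "(_, True)"] this[of "(_, False)"]
    show False using no h by (auto simp: I_def \<kappa>_def side_mult_def)
  qed
  moreover have "convex (\<kappa> ` halfFA cs)"
  proof (rule convexI)
    fix u v and p q :: real
    assume "u \<in> \<kappa> ` halfFA cs" "v \<in> \<kappa> ` halfFA cs" and pq: "p \<ge> 0" "q \<ge> 0" "p + q = 1"
    then obtain h k where h: "h \<in> halfFA cs" "k \<in> halfFA cs" "u = \<kappa> h" "v = \<kappa> k" by auto
    have one: "p *\<^sub>R b + q *\<^sub>R b = b" for b :: 'a using pq by (simp flip: scaleR_add_left)
    have "p *\<^sub>R u + q *\<^sub>R v = \<kappa> (p *\<^sub>R h + q *\<^sub>R k)"
    proof
      fix i
      have "(p *\<^sub>R u + q *\<^sub>R v) i = side_mult (snd i) (p *\<^sub>R h + q *\<^sub>R k, 0) (fst i) - (p *\<^sub>R fst i + q *\<^sub>R fst i)"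
        by (simp add: h \<kappa>_def side_mult_def algebra_simps)
      then show "(p *\<^sub>R u + q *\<^sub>R v) i = \<kappa> (p *\<^sub>R h + q *\<^sub>R k) i" by (simp only: one \<kappa>_def)
    qed
    then show "p *\<^sub>R u + q *\<^sub>R v \<in> \<kappa> ` halfFA cs"
      using convexD[OF convex_halfFA h(1,2) pq] by simp
  qed
  moreover have "0 \<in> halfFA cs" by (simp add: halfFA_def unorm_one_le)
  ultimately obtain \<phi> where \<phi>: "linear_functional_on UNIV \<phi>" "\<And>u. \<phi> u \<le> N u" "\<And>h. h \<in> halfFA cs \<Longrightarrow> e \<le> \<phi> (\<kappa> h)"
    by (rule_tac convex_separation[of UNIV N "\<kappa> ` halfFA cs" e]) (use Nsub in auto)
  have add: "\<phi> (u + v) = \<phi> u + \<phi> v" and scale: "\<phi> (t *\<^sub>R u) = t * \<phi> u" for u v t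
    using \<phi>(1) unfolding linear_functional_on_def by blast+
  define \<delta> :: "'a \<times> bool \<Rightarrow> 'a \<Rightarrow> 'a \<times> bool \<Rightarrow> 'a" where "\<delta> = (\<lambda>i a j. if j = i then a else 0)"
  have "\<exists>G\<in>A.cdual. \<forall>a. Re (G a) = \<phi> (\<delta> i a)" if i: "i \<in> I" for i
  proof -
    have "\<delta> i (a + b) = \<delta> i a + \<delta> i b" "\<delta> i (t *\<^sub>R a) = t *\<^sub>R \<delta> i a" for a b t
      by (auto simp: \<delta>_def fun_eq_iff)
    then have lin: "linear_functional_on UNIV (\<lambda>a. \<phi> (\<delta> i a))"
      by (simp add: linear_functional_on_def add scale)
    have "N (\<delta> i a) = norm a" for a
      using i I by (simp add: N_def \<delta>_def if_distrib[of norm] cong: if_cong)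
    then have "\<phi> (\<delta> i a) \<le> 1 * norm a" for a using \<phi>(2)[of "\<delta> i a"] by simp
    then show ?thesis using A.complexify_functional[OF lin, of 1] by (metis UNIV_I zero_le_one)
  qed
  then obtain G where G: "\<And>i. i \<in> I \<Longrightarrow> G i \<in> A.cdual" "\<And>i a. i \<in> I \<Longrightarrow> Re (G i a) = \<phi> (\<delta> i a)" by metis
  have \<phi>_sum: "\<phi> u = (\<Sum>i\<in>I. Re (G i (u i)))" for u
  proof -
    \<comment> \<open>\<open>N\<close> ignores coordinates outside \<open>I\<close>, so
      \<open>\<phi>\<close> vanishes on them.\<close>
    let ?u = "\<lambda>i. if i \<in> I then u i else 0"
    have "N (u - ?u) = 0" "N (?u - u) = 0" by (simp_all add: N_def)
    then have "\<phi> (u - ?u) \<le> 0" "\<phi> (?u - u) \<le> 0" using \<phi>(2) by metis+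
    moreover have "\<phi> u = \<phi> ?u + \<phi> (u - ?u)" "\<phi> ?u = \<phi> u + \<phi> (?u - u)" by (simp_all flip: add)
    ultimately have "\<phi> u = \<phi> ?u" by linarith
    also have "\<dots> = (\<Sum>i\<in>I. \<phi> (\<delta> i (u i)))"
      unfolding \<delta>_def using \<phi>(1) I by (rule linear_functional_on_coordinates)
    finally show ?thesis using G(2) by simp
  qed
  define g where "g = (\<lambda>i. slice (snd i) (G i) (fst i))"
  have g: "g i \<in> dual1 cs" "Pr one2 (g i) = G i (fst i)" if "i \<in> I" for i
    using G(1)[OF that] slice_dual1 Pr_one_slice by (auto simp: g_def)
  \<comment> \<open>The added 1 keeps the sum of the errors over \<open>I\<close> strictly below
    \<open>e\<close>, also for empty \<open>I\<close>.\<close>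
  define \<epsilon> where "\<epsilon> = e / (real (card I) + 1)"
  have \<epsilon>: "\<epsilon> > 0" using e by (simp add: \<epsilon>_def)
  have "finite (g ` I) \<and> g ` I \<subseteq> dual1 cs" using I g by auto
  then obtain a where a: "a \<in> FA cs" "\<And>i. i \<in> I \<Longrightarrow> cmod (canon (a, 0) (g i) - 2 * Pr one2 (g i)) < \<epsilon>"
    using FA_weak_star_dense twice_Pr_one_FAbb \<epsilon> unfolding weak_star_dense_def
    by (smt (verit, del_insts) image_iff)
  define h where "h = (1 / 2) *\<^sub>R a"
  have h: "h \<in> halfFA cs" using a(1) by (simp add: h_def halfFA_def FA_def cs_two)
  have "Re (G i (\<kappa> h i)) \<le> \<epsilon>" if i: "i \<in> I" for i
  proof -
    have "G i (\<kappa> h i) = g i (h, 0) - G i (fst i)"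
      using A.cdual_diff[OF G(1)[OF i]] by (simp add: \<kappa>_def g_def)
    also have "g i (h, 0) = (1 / 2) *\<^sub>R g i (a, 0)"
      using X.cdual_scaleR[OF g(1)[OF i], of "(a, 0)" "1 / 2"] by (simp add: h_def)
    finally have "2 * G i (\<kappa> h i) = canon (a, 0) (g i) - 2 * Pr one2 (g i)"
      using g(2)[OF i] by (simp add: canon_def scaleR_conv_of_real algebra_simps)
    then have "cmod (2 * G i (\<kappa> h i)) < \<epsilon>" using a(2)[OF i] by simp
    then have "2 * cmod (G i (\<kappa> h i)) < \<epsilon>" by (simp add: norm_mult)
    then show ?thesis using complex_Re_le_cmod[of "G i (\<kappa> h i)"] norm_ge_zero[of "G i (\<kappa> h i)"]
      by linarith
  qed
  then have "\<phi> (\<kappa> h) \<le> (\<Sum>i\<in>I. \<epsilon>)" unfolding \<phi>_sum by (intro sum_mono)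
  also have "\<dots> < e" using e by (simp add: \<epsilon>_def field_simps)
  finally show False using \<phi>(3)[OF h] by simp
qed

text \<open>The filter is generated by the sets \<open>S (B, e)\<close>, directed through unions of
  the \<open>B\<close> and minima of the \<open>e\<close>, and nonempty by
  \<open>halfFA_approximate_unit\<close>.\<close>

theorem cai_in_halfFA: "cai_in (halfFA cs)"
proof -
  define J :: "('a set \<times> real) set" where "J = {(B, e). finite B \<and> e > 0}"
  define S where "S = (\<lambda>j. {h \<in> halfFA cs. \<forall>b\<in>fst j. norm (h * b - b) < snd j \<and> norm (b * h - b) < snd j})"
  define F where "F = (INF j\<in>J. principal (S j))"
  have ev: "eventually P F \<longleftrightarrow> (\<exists>j\<in>J. \<forall>h\<in>S j. P h)" for P
    unfolding F_def
  proof (subst eventually_INF_base)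
    show "J \<noteq> {}" by (auto simp: J_def intro: exI[of _ "{}"] exI[of _ 1])
    fix i j assume "i \<in> J" "j \<in> J"
    then show "\<exists>k\<in>J. principal (S k) \<le> inf (principal (S i)) (principal (S j))"
      by (intro bexI[of _ "(fst i \<union> fst j, min (snd i) (snd j))"]) (auto simp: J_def S_def)
  qed (simp add: eventually_principal)
  have "S j \<noteq> {}" if "j \<in> J" for j
    using halfFA_approximate_unit[of "fst j" "snd j"] that by (auto simp: J_def S_def)
  then have "F \<noteq> bot" unfolding trivial_limit_def ev by blast
  moreover have "eventually (\<lambda>h. h \<in> halfFA cs \<and> norm h \<le> 1) F"
    unfolding ev by (rule bexI[of _ "({}, 1)"]) (auto simp: S_def J_def halfFA_norm_le)
  moreover have "((\<lambda>h. h * a) \<longlongrightarrow> a) F" "((\<lambda>h. a * h) \<longlongrightarrow> a) F" for a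
  proof -
    have "eventually (\<lambda>h. norm (h * a - a) < e) F" "eventually (\<lambda>h. norm (a * h - a) < e) F" if "e > 0" for e
      unfolding ev by (rule bexI[of _ "({a}, e)"]; use that in \<open>auto simp: S_def J_def\<close>)+
    then show "((\<lambda>h. h * a) \<longlongrightarrow> a) F" "((\<lambda>h. a * h) \<longlongrightarrow> a) F"
      by (simp_all add: tendsto_iff dist_norm)
  qed
  ultimately show ?thesis unfolding cai_in_def by blast
qed

end

theorem theorem5p2:
  fixes cs :: "complex \<Rightarrow> 'a::{real_normed_algebra,banach} \<Rightarrow> 'a"
  assumes "complex_banach_algebra cs"
    and "M_approx_unital cs"
  shows "weak_star_dense cs ((\<lambda>a. canon (a, 0)) ` FA cs) (FAbb cs)
       \<and> weak_star_dense cs ((\<lambda>a. canon (a, 0)) ` rA cs) (rAbb cs)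
       \<and> cai_in (halfFA cs)"
proof -
  have "cai_in (UNIV :: 'a set)"
    using assms(2) by (simp add: M_approx_unital_def approx_unital_def)
  moreover obtain Pr where Pr:
    "\<forall>P\<in>dual2 cs. Pr P \<in> Aperpperp cs"
    "\<forall>P\<in>dual2 cs. \<forall>Q\<in>dual2 cs. \<forall>f\<in>dual1 cs. Pr (\<lambda>g. P g + Q g) f = Pr P f + Pr Q f"
    "\<forall>c. \<forall>P\<in>dual2 cs. \<forall>f\<in>dual1 cs. Pr (\<lambda>g. c * P g) f = c * Pr P f"
    "\<forall>P\<in>Aperpperp cs. \<forall>f\<in>dual1 cs. Pr P f = P f"
    "\<forall>P\<in>dual2 cs. bnorm cs P = max (bnorm cs (Pr P)) (bnorm cs (\<lambda>f. P f - Pr P f))"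
    using assms(2) unfolding M_approx_unital_def M_ideal_in_unitization_def by blast
  ultimately interpret M_ideal_algebra cs Pr
    using assms(1) by unfold_locales blast+
  show ?thesis using FA_weak_star_dense rA_weak_star_dense cai_in_halfFA by blast
qed

end
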